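(* Let $G$ be a countably infinite sofic group, $\Sigma=\{\sigma_i:G\to\mathrm{Sym}(n_i)\}_{i\in\mathbb{N}}$ a sofic approximation sequence for $G$, and $G\curvearrowright X$ an expansive action on a compact metrizable space by homeomorphisms with the topological Markov property. (1) Suppose that $(x,y)\in X^2$ is an asymptotic pair with $x\neq y$ and $x\in\mathrm{IE}^\Sigma_1(X,G)$. Then $(x,y)\in\mathrm{IE}^\Sigma_2(X,G)$. In particular, $h^\Sigma_{\rm top}(G\curvearrowright X)>0$. (2) If $\mathrm{IE}^\Sigma_1(X,G)=X$ and the set $\mathtt{A}_2(X,G)$ of asymptotic pairs satisfies $\overline{\mathtt{A}_2(X,G)}=X^2$, then $G\curvearrowright X$ has sofic UPE of all orders (with respect to $\Sigma$).
   Context: Fix a compatible metric $d$ on $X$ (the notions below do not depend on its choice). For $K\subset G$ and $x,y\in X$ write $d_K(x,y)=\sup_{g\in K}d(gx,gy)$. Sofic approximation sequence: positive integers $n_i\to\infty$ and maps $\sigma_i:G\to\mathrm{Sym}(n_i)$ such that $\frac1{n_i}|\{v:\sigma_i(st)v=\sigma_i(s)\sigma_i(t)v\}|\to1$ for all $s,t\in G$ and $\frac1{n_i}|\{v:\sigma_i(s)v\ne\sigma_i(t)v\}|\to1$ for all $s\neq t$ in $G$. $G$ is sofic if it admits one. Expansive: there is $c>0$ such that for all $x\neq y$ in $X$ there is $g\in G$ with $d(gx,gy)>c$. Asymptotic pair: $(x,y)\in X^2$ such that for every $\varepsilon>0$ there is a finite $F\subset G$ with $d(gx,gy)\le\varepsilon$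 for all $g\notin F$. Memory set: for $\varepsilon,\delta>0$ and finite $A\subset B\subset G$, $B$ is an $(\varepsilon,\delta)$-memory set for $A$ if for every $x,y\in X$ with $d_{B\setminus A}(x,y)\le\delta$ there is $z\in X$ with $d_B(x,z)\le\varepsilon$ and $d_{G\setminus A}(y,z)\le\varepsilon$. Topological Markov property (TMP): for every $\varepsilon>0$ there is $\delta>0$ such that every finite $A\subset G$ admits an $(\varepsilon,\delta)$-memory set. For finite $F\subset G$, $\delta>0$, $\sigma:G\to\mathrm{Sym}(n)$, $\mathrm{Map}(d,F,\delta,\sigma)$ is the set of maps $\varphi:\{1,\dots,n\}\to X$ with $\big(\frac1n\sum_{v=1}^n d(\varphi(\sigma(s)v),s\varphi(v))^2\big)^{1/2}\le\delta$ for every $s\in F$. $N_\varepsilon(Y,d_\infty)$ is the maximal cardinality of a subset of $Y\subset X^{\{1,\dots,n\}}$ whose distinct elements $\varphi_1,\varphi_2$ satisfy $\max_v d(\varphi_1(v),\varphi_2(v))\ge\varepsilon$. Sofic topological entropy: $h^\Sigma_{\rm top}(G\curvearrowright X)=\sup_{\varepsilon>0}\inf_{F\subset G\text{ finite}}\inf_{\delta>0}\limsup_{i\to\infty}\frac1{n_i}\log N_\varepsilon(\mathrm{Map}(d,F,\delta,\sigma_i),d_\infty)$ (with $\log0=-\infty$). For a tuple $\mathbf A=(A_1,\dots,A_k)$ of subsets of $X$, $J\subset\{1,\dots,n\}$ is a $(d,F,\delta,\sigma)$-independence set for $\mathbf A$ if for every $\omega:J\to\{1,\dots,k\}$ there is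 $\varphi\in\mathrm{Map}(d,F,\delta,\sigma)$ with $\varphi(a)\in A_{\omega(a)}$ for all $a\in J$. $\mathbf A$ has positive upper independence density over $\Sigma$ if there is $q>0$ such that for every finite $F\subset G$ and $\delta>0$ there are infinitely many $i$ for which $\mathbf A$ has a $(d,F,\delta,\sigma_i)$-independence set of cardinality at least $qn_i$. $\mathrm{IE}^\Sigma_k(X,G)$ ($k\ge1$) is the set of $(x_1,\dots,x_k)\in X^k$ such that for every product neighborhood $U_1\times\dots\times U_k$ of it, $(U_1,\dots,U_k)$ has positive upper independence density over $\Sigma$. Sofic UPE of all orders: $\mathrm{IE}^\Sigma_k(X,G)=X^k$ for all $k\ge2$. *)

theory Defs
  imports "HOL-Analysis.Analysis" "HOL-Algebra.Group_Action" "HOL-Algebra.Sym_Groups"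
begin

text \<open>
  Throughout, the compact metrizable space is a set \<open>X\<close> in a type of class \<open>metric_space\<close>, the fixed
  compatible metric is \<open>dist\<close>, and \<open>\<alpha> g x\<close> stands for the image of \<open>x\<close> under the
  group element \<open>g\<close>. A sequence of maps from \<open>G\<close> to the symmetric groups on \<open>n i\<close> letters is given by
  the degrees \<open>n\<close> together with the maps \<open>\<sigma> i\<close>.
\<close>

definition continuous_action ::
    "('g, 'm) monoid_scheme \<Rightarrow> 'x::metric_space set \<Rightarrow> ('g \<Rightarrow> 'x \<Rightarrow> 'x) \<Rightarrow> bool" where
  "continuous_action G X \<alpha> \<longleftrightarrow>
     group_action G X \<alpha> \<and>
     (\<forall>g\<in>carrier G. homeomorphism X X (\<alpha> g) (\<alpha> (inv\<^bsub>G\<^esub> g)))"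

subsection \<open>Sofic groups\<close>

definition sofic_approximation ::
    "('g, 'm) monoid_scheme \<Rightarrow> (nat \<Rightarrow> nat) \<Rightarrow> (nat \<Rightarrow> 'g \<Rightarrow> nat \<Rightarrow> nat) \<Rightarrow> bool" where
  "sofic_approximation G n \<sigma> \<longleftrightarrow>
     (\<forall>i. n i > 0) \<and> filterlim n at_top sequentially \<and>
     (\<forall>i. \<forall>s\<in>carrier G. \<sigma> i s \<in> carrier (sym_group (n i))) \<and>
     (\<forall>s\<in>carrier G. \<forall>t\<in>carrier G.
        (\<lambda>i. real (card {v\<in>{1..n i}. \<sigma> i (s \<otimes>\<^bsub>G\<^esub> t) v = \<sigma> i s (\<sigma> i t v)}) / real (n i))
          \<longlonglongrightarrow> 1) \<and>
     (\<forall>s\<in>carrier G. \<forall>t\<in>carrier G. s \<noteq> t \<longrightarrow>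
        (\<lambda>i. real (card {v\<in>{1..n i}. \<sigma> i s v \<noteq> \<sigma> i t v}) / real (n i)) \<longlonglongrightarrow> 1)"

definition sofic_group :: "('g, 'm) monoid_scheme \<Rightarrow> bool" where
  "sofic_group G \<longleftrightarrow> group G \<and> (\<exists>n \<sigma>. sofic_approximation G n \<sigma>)"

subsection \<open>Expansiveness, asymptotic pairs and the topological Markov property\<close>

definition expansive ::
    "('g, 'm) monoid_scheme \<Rightarrow> 'x::metric_space set \<Rightarrow> ('g \<Rightarrow> 'x \<Rightarrow> 'x) \<Rightarrow> bool" where
  "expansive G X \<alpha> \<longleftrightarrow>
     (\<exists>c>0. \<forall>x\<in>X. \<forall>y\<in>X. x \<noteq> y \<longrightarrow> (\<exists>g\<in>carrier G. dist (\<alpha> g x) (\<alpha> g y) > c))"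

definition asymptotic_pairs ::
    "('g, 'm) monoid_scheme \<Rightarrow> 'x::metric_space set \<Rightarrow> ('g \<Rightarrow> 'x \<Rightarrow> 'x) \<Rightarrow> ('x \<times> 'x) set" where
  "asymptotic_pairs G X \<alpha> =
     {(x, y) \<in> X \<times> X. \<forall>\<epsilon>>0. \<exists>F. finite F \<and> F \<subseteq> carrier G \<and>
        (\<forall>g\<in>carrier G - F. dist (\<alpha> g x) (\<alpha> g y) \<le> \<epsilon>)}"

text \<open>The supremum is taken in \<^typ>\<open>ennreal\<close>, so that it is \<open>0\<close> for \<open>K = {}\<close>.\<close>

definition dist_on ::
    "('g \<Rightarrow> 'x::metric_space \<Rightarrow> 'x) \<Rightarrow> 'g set \<Rightarrow> 'x \<Rightarrow> 'x \<Rightarrow> ennreal" where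
  "dist_on \<alpha> K x y = (SUP g\<in>K. ennreal (dist (\<alpha> g x) (\<alpha> g y)))"

definition memory_set ::
    "('g, 'm) monoid_scheme \<Rightarrow> 'x::metric_space set \<Rightarrow> ('g \<Rightarrow> 'x \<Rightarrow> 'x) \<Rightarrow>
     real \<Rightarrow> real \<Rightarrow> 'g set \<Rightarrow> 'g set \<Rightarrow> bool" where
  "memory_set G X \<alpha> \<epsilon> \<delta> A B \<longleftrightarrow>
     finite B \<and> A \<subseteq> B \<and> B \<subseteq> carrier G \<and>
     (\<forall>x\<in>X. \<forall>y\<in>X. dist_on \<alpha> (B - A) x y \<le> ennreal \<delta> \<longrightarrow>
        (\<exists>z\<in>X. dist_on \<alpha> B x z \<le> ennreal \<epsilon> \<and> dist_on \<alpha> (carrier G - A) y z \<le> ennreal \<epsilon>))"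

definition topological_Markov_property ::
    "('g, 'm) monoid_scheme \<Rightarrow> 'x::metric_space set \<Rightarrow> ('g \<Rightarrow> 'x \<Rightarrow> 'x) \<Rightarrow> bool" where
  "topological_Markov_property G X \<alpha> \<longleftrightarrow>
     (\<forall>\<epsilon>>0. \<exists>\<delta>>0. \<forall>A. finite A \<and> A \<subseteq> carrier G \<longrightarrow> (\<exists>B. memory_set G X \<alpha> \<epsilon> \<delta> A B))"

subsection \<open>Sofic topological entropy\<close>

text \<open>Here \<open>N\<close> is the degree and \<open>s\<close> a single map from the group to the permutations of \<open>{1..N}\<close>.\<close>

definition sofic_Map ::
    "'x::metric_space set \<Rightarrow> ('g \<Rightarrow> 'x \<Rightarrow> 'x) \<Rightarrow> 'g set \<Rightarrow> real \<Rightarrow> nat \<Rightarrow> ('g \<Rightarrow> nat \<Rightarrow> nat) \<Rightarrow>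
     (nat \<Rightarrow> 'x) set" where
  "sofic_Map X \<alpha> F \<delta> N s =
     {\<phi> \<in> {1..N} \<rightarrow>\<^sub>E X. \<forall>g\<in>F.
        sqrt (1 / real N * (\<Sum>v=1..N. (dist (\<phi> (s g v)) (\<alpha> g (\<phi> v)))\<^sup>2)) \<le> \<delta>}"

definition max_dist :: "nat \<Rightarrow> (nat \<Rightarrow> 'x::metric_space) \<Rightarrow> (nat \<Rightarrow> 'x) \<Rightarrow> real" where
  "max_dist N \<phi> \<psi> = (MAX v\<in>{1..N}. dist (\<phi> v) (\<psi> v))"

text \<open>Valued in \<^typ>\<open>enat\<close> so as to be meaningful for every \<open>Y\<close>; it is finite when \<open>X\<close> is compact.\<close>

definition separation_number :: "real \<Rightarrow> nat \<Rightarrow> (nat \<Rightarrow> 'x::metric_space) set \<Rightarrow> enat" where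
  "separation_number \<epsilon> N Y =
     (SUP S \<in> {S. S \<subseteq> Y \<and> finite S \<and> (\<forall>\<phi>\<in>S. \<forall>\<psi>\<in>S. \<phi> \<noteq> \<psi> \<longrightarrow> max_dist N \<phi> \<psi> \<ge> \<epsilon>)}. enat (card S))"

definition ln_enat :: "enat \<Rightarrow> ereal" where
  "ln_enat m = (case m of enat k \<Rightarrow> if k = 0 then - \<infinity> else ereal (ln (real k)) | \<infinity> \<Rightarrow> \<infinity>)"

definition sofic_top_entropy ::
    "('g, 'm) monoid_scheme \<Rightarrow> (nat \<Rightarrow> nat) \<Rightarrow> (nat \<Rightarrow> 'g \<Rightarrow> nat \<Rightarrow> nat) \<Rightarrow>
     'x::metric_space set \<Rightarrow> ('g \<Rightarrow> 'x \<Rightarrow> 'x) \<Rightarrow> ereal" where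
  "sofic_top_entropy G n \<sigma> X \<alpha> =
     (SUP \<epsilon>\<in>{0<..}. INF F\<in>{F. finite F \<and> F \<subseteq> carrier G}. INF \<delta>\<in>{0<..}.
        limsup (\<lambda>i. ereal (1 / real (n i)) *
                     ln_enat (separation_number \<epsilon> (n i) (sofic_Map X \<alpha> F \<delta> (n i) (\<sigma> i)))))"

subsection \<open>Independence and sofic IE-tuples\<close>

text \<open>Tuples are lists, so the components of a \<open>k\<close>-tuple are indexed by \<open>{..<k}\<close>.\<close>

definition tuples :: "'x set \<Rightarrow> nat \<Rightarrow> 'x list set" where
  "tuples X k = {xs. set xs \<subseteq> X \<and> length xs = k}"

definition independence_set ::
    "'x::metric_space set \<Rightarrow> ('g \<Rightarrow> 'x \<Rightarrow> 'x) \<Rightarrow> 'g set \<Rightarrow> real \<Rightarrow> nat \<Rightarrow> ('g \<Rightarrow> nat \<Rightarrow> nat) \<Rightarrow>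
     'x set list \<Rightarrow> nat set \<Rightarrow> bool" where
  "independence_set X \<alpha> F \<delta> N s As J \<longleftrightarrow>
     J \<subseteq> {1..N} \<and>
     (\<forall>\<omega> \<in> J \<rightarrow>\<^sub>E {..<length As}. \<exists>\<phi>\<in>sofic_Map X \<alpha> F \<delta> N s. \<forall>a\<in>J. \<phi> a \<in> As ! \<omega> a)"

definition positive_upper_independence_density ::
    "('g, 'm) monoid_scheme \<Rightarrow> (nat \<Rightarrow> nat) \<Rightarrow> (nat \<Rightarrow> 'g \<Rightarrow> nat \<Rightarrow> nat) \<Rightarrow>
     'x::metric_space set \<Rightarrow> ('g \<Rightarrow> 'x \<Rightarrow> 'x) \<Rightarrow> 'x set list \<Rightarrow> bool" where
  "positive_upper_independence_density G n \<sigma> X \<alpha> As \<longleftrightarrow>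
     (\<exists>q>0. \<forall>F \<delta>. finite F \<and> F \<subseteq> carrier G \<and> \<delta> > 0 \<longrightarrow>
        infinite {i. \<exists>J. independence_set X \<alpha> F \<delta> (n i) (\<sigma> i) As J \<and>
                         real (card J) \<ge> q * real (n i)})"

definition neighbourhood_in :: "'x::topological_space set \<Rightarrow> 'x \<Rightarrow> 'x set \<Rightarrow> bool" where
  "neighbourhood_in X x U \<longleftrightarrow> U \<subseteq> X \<and> (\<exists>T. openin (top_of_set X) T \<and> x \<in> T \<and> T \<subseteq> U)"

definition IE ::
    "('g, 'm) monoid_scheme \<Rightarrow> (nat \<Rightarrow> nat) \<Rightarrow> (nat \<Rightarrow> 'g \<Rightarrow> nat \<Rightarrow> nat) \<Rightarrow>
     'x::metric_space set \<Rightarrow> ('g \<Rightarrow> 'x \<Rightarrow> 'x) \<Rightarrow> nat \<Rightarrow> 'x list set" where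
  "IE G n \<sigma> X \<alpha> k =
     {xs \<in> tuples X k. \<forall>Us. length Us = k \<and> (\<forall>j<k. neighbourhood_in X (xs ! j) (Us ! j)) \<longrightarrow>
        positive_upper_independence_density G n \<sigma> X \<alpha> Us}"

definition sofic_UPE_all_orders ::
    "('g, 'm) monoid_scheme \<Rightarrow> (nat \<Rightarrow> nat) \<Rightarrow> (nat \<Rightarrow> 'g \<Rightarrow> nat \<Rightarrow> nat) \<Rightarrow>
     'x::metric_space set \<Rightarrow> ('g \<Rightarrow> 'x \<Rightarrow> 'x) \<Rightarrow> bool" where
  "sofic_UPE_all_orders G n \<sigma> X \<alpha> \<longleftrightarrow> (\<forall>k\<ge>2. IE G n \<sigma> X \<alpha> k = tuples X k)"

end

theory Submission
  imports Defs
begin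

text \<open>
  Let \<open>x\<close> be a \<open>1\<close>-IE-point and let \<open>y_j\<close> be asymptotic to \<open>x\<close>, equal up to a small error off a finite
  set \<open>A\<close>, with memory set \<open>B\<close>. A sofic model \<open>\<phi>\<close> with values near \<open>x\<close> at a positive proportion of the
  vertices contains a positive proportion of such vertices that are far apart from each other in the
  sofic graph. Near each of these vertices the orbit follows \<open>x\<close> along \<open>B\<close>, so the Markov property
  lets one replace it there by any of the \<open>y_j\<close>. For a vertex \<open>v\<close> all replacements visible from \<open>v\<close>
  in a large finite window are made successively in the orbit of \<open>\<phi> v\<close>; expansiveness keeps the errors
  from accumulating, and, since only finitely many coordinates decide closeness, it also shows that
  the new map is again approximately equivariant.

  For tuples of arbitrary length one uses that the set of points with an asymptotic partner in a given
  open set contains an open subset of every nonempty open set, so partners in several open sets are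
  found one after the other.
\<close>

section \<open>Expansive actions and gluing along an orbit\<close>

locale compact_action = group G for G :: "('g, 'm) monoid_scheme" (structure) +
  fixes X :: "'x::metric_space set" and \<alpha>
  assumes compact: "compact X" and action: "continuous_action G X \<alpha>"
begin

lemma group_action: "group_action G X \<alpha>"
  using action by (simp add: continuous_action_def)

lemma act_closed [simp]: "g \<in> carrier G \<Longrightarrow> x \<in> X \<Longrightarrow> \<alpha> g x \<in> X"
  using group_action.element_image[OF group_action] by blast

lemma act_mult: "x \<in> X \<Longrightarrow> g \<in> carrier G \<Longrightarrow> h \<in> carrier G \<Longrightarrow> \<alpha> g (\<alpha> h x) = \<alpha> (g \<otimes> h) x"
  using group_action.composition_rule[OF group_action] by simp

lemma act_one [simp]: "x \<in> X \<Longrightarrow> \<alpha> \<one> x = x"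
  using group_action.id_eq_one[OF group_action] by (metis restrict_apply')

lemma act_continuous: "g \<in> carrier G \<Longrightarrow> continuous_on X (\<alpha> g)"
  using action unfolding continuous_action_def homeomorphism_def by blast

lemma act_equicontinuous:
  assumes "finite K" "K \<subseteq> carrier G" "\<eta> > 0"
  shows "\<exists>\<delta>>0. \<forall>u\<in>X. \<forall>w\<in>X. dist u w \<le> \<delta> \<longrightarrow> (\<forall>g\<in>K. dist (\<alpha> g u) (\<alpha> g w) \<le> \<eta>)"
  using assms(1,2)
proof (induction K rule: finite_induct)
  case empty
  then show ?case using zero_less_one by blast
next
  case (insert g K)
  then obtain \<delta>1 where \<delta>1: "\<delta>1 > 0"
    "\<And>u w h. u \<in> X \<Longrightarrow> w \<in> X \<Longrightarrow> dist u w \<le> \<delta>1 \<Longrightarrow> h \<in> K \<Longrightarrow> dist (\<alpha> h u) (\<alpha> h w) \<le> \<eta>"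
    by auto
  have "uniformly_continuous_on X (\<alpha> g)"
    using insert.prems act_continuous compact compact_uniformly_continuous by auto
  then obtain \<delta>2 where \<delta>2: "\<delta>2 > 0"
    "\<And>u w. u \<in> X \<Longrightarrow> w \<in> X \<Longrightarrow> dist u w < \<delta>2 \<Longrightarrow> dist (\<alpha> g u) (\<alpha> g w) < \<eta>"
    unfolding uniformly_continuous_on_def using \<open>\<eta> > 0\<close> by metis
  show ?case
    by (rule exI[of _ "min \<delta>1 (\<delta>2 / 2)"])
      (use \<delta>1 \<delta>2 in \<open>fastforce intro: less_imp_le\<close>)
qed

end

section \<open>Expansiveness tested on finite windows\<close>

locale expansive_action = compact_action G X \<alpha>
  for G :: "('g, 'm) monoid_scheme" (structure) and X :: "'x::metric_space set" and \<alpha> +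
  fixes c :: real
  assumes c_pos: "c > 0"
    and expansive_const: "\<lbrakk>x \<in> X; y \<in> X; x \<noteq> y\<rbrakk> \<Longrightarrow> \<exists>g\<in>carrier G. dist (\<alpha> g x) (\<alpha> g y) > c"
begin

text \<open>Compactness makes expansiveness quantitative: by expansiveness, the open sets of pairs
  that some \<open>g\<close> moves more than \<open>c\<close> apart, together with the
  \<open>\<epsilon>\<close>-neighbourhood \<open>W\<close> of the diagonal, cover
  \<open>X \<times> X\<close>. The group elements occurring in a finite subcover form
  \<open>E\<close>.\<close>

lemma expansive_finite_window:
  assumes "\<epsilon> > 0"
  shows "\<exists>E. finite E \<and> E \<subseteq> carrier G \<and>
    (\<forall>u\<in>X. \<forall>w\<in>X. (\<forall>g\<in>E. dist (\<alpha> g u) (\<alpha> g w) \<le> c) \<longrightarrow> dist u w < \<epsilon>)"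
proof -
  define U where "U g = {p \<in> X \<times> X. dist (\<alpha> g (fst p)) (\<alpha> g (snd p)) > c}" for g
  define W where "W = {p \<in> X \<times> X. dist (fst p) (snd p) < \<epsilon>}"
  have opn: "openin (top_of_set (X \<times> X)) (U g)" if "g \<in> carrier G" for g
  proof -
    have "continuous_on (X \<times> X) (\<lambda>p. dist (\<alpha> g (fst p)) (\<alpha> g (snd p)))"
      by (intro continuous_on_dist continuous_on_compose2[OF act_continuous[OF that]])
        (auto intro: continuous_intros)
    from continuous_openin_preimage_gen[OF this, of "{c<..}"] show ?thesis
      by (simp add: U_def vimage_def Int_def)
  qed
  have "continuous_on (X \<times> X) (\<lambda>p. dist (fst p) (snd p))"
    by (intro continuous_intros)
  from continuous_openin_preimage_gen[OF this, of "{..<\<epsilon>}"]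
  have opnW: "openin (top_of_set (X \<times> X)) W"
    by (simp add: W_def vimage_def Int_def)
  have cover: "X \<times> X \<subseteq> \<Union>(insert W (U ` carrier G))"
  proof
    fix p assume p: "p \<in> X \<times> X"
    show "p \<in> \<Union>(insert W (U ` carrier G))"
    proof (cases "fst p = snd p")
      case True
      then show ?thesis using p assms by (auto simp: W_def)
    next
      case False
      then obtain g where "g \<in> carrier G" "dist (\<alpha> g (fst p)) (\<alpha> g (snd p)) > c"
        using expansive_const[of "fst p" "snd p"] p by (auto simp: mem_Times_iff)
      then show ?thesis using p by (auto simp: U_def)
    qed
  qed
  have "compact (X \<times> X)" using compact by (intro compact_Times)
  then have "\<exists>D\<subseteq>\<C>. finite D \<and> X \<times> X \<subseteq> \<Union>D"
    if "\<forall>c\<in>\<C>. openin (top_of_set (X \<times> X)) c" "X \<times> X \<subseteq> \<Union>\<C>" for \<C>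
    unfolding compact_eq_openin_cover using that by blast
  moreover have "\<forall>c\<in>insert W (U ` carrier G). openin (top_of_set (X \<times> X)) c"
    using opn opnW by simp
  ultimately obtain D where D: "D \<subseteq> insert W (U ` carrier G)" "finite D" "X \<times> X \<subseteq> \<Union>D"
    using cover by metis
  have "finite (D - {W})" "D - {W} \<subseteq> U ` carrier G" using D by auto
  then obtain E where E: "E \<subseteq> carrier G" "finite E" "D - {W} = U ` E"
    by (meson finite_subset_image)
  show ?thesis
  proof (intro exI[of _ E] conjI ballI impI)
    fix u w assume uw: "u \<in> X" "w \<in> X"
      and le: "\<forall>g\<in>E. dist (\<alpha> g u) (\<alpha> g w) \<le> c"
    have "(u, w) \<notin> \<Union>(D - {W})"
      using le unfolding E(3) by (force simp: U_def)
    then have "(u, w) \<in> W" using D(3) uw by blast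
    then show "dist u w < \<epsilon>" by (simp add: W_def)
  qed (use E in auto)
qed

end

text \<open>
  The points \<open>z 0, z 1, \<dots>, z m\<close> arise by changing the orbit successively near the locations
  \<open>loc 0, \<dots>, loc (m - 1)\<close>. Each single change moves the orbit by up to \<open>\<epsilon>\<close> everywhere; expansiveness
  turns this into the better bound \<open>\<epsilon>'\<close> away from the location, so the errors do not accumulate.
\<close>

locale gluing = expansive_action G X \<alpha> c
  for G :: "('g, 'm) monoid_scheme" (structure) and X :: "'x::metric_space set" and \<alpha> and c +
  fixes \<epsilon> \<epsilon>' :: real and A E C :: "'g set" and loc :: "nat \<Rightarrow> 'g" and m :: nat
  assumes \<epsilon>_le: "2 * \<epsilon> \<le> c" and \<epsilon>'_le: "2 * \<epsilon>' \<le> \<epsilon>" and \<epsilon>'_pos: "0 \<le> \<epsilon>'"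
    and window: "\<lbrakk>u \<in> X; w \<in> X; \<And>g. g \<in> E \<Longrightarrow> dist (\<alpha> g u) (\<alpha> g w) \<le> c\<rbrakk> \<Longrightarrow> dist u w < \<epsilon>'"
    and E_sub: "E \<subseteq> carrier G"
    and C_E: "\<lbrakk>h \<in> carrier G; e \<in> E; e \<otimes> h \<in> A\<rbrakk> \<Longrightarrow> h \<in> C"
    and loc_carrier: "l < m \<Longrightarrow> loc l \<in> carrier G"
    and loc_disjoint: "\<lbrakk>l < m; p < m; l \<noteq> p; h \<in> carrier G; h \<otimes> inv (loc l) \<in> C\<rbrakk> \<Longrightarrow>
                        h \<otimes> inv (loc p) \<notin> C"
begin

text \<open>Only the control away from the changed location is recorded here. That the change at
  \<open>loc i\<close> follows a prescribed point is kept apart, in \<open>glued_exists\<close>,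
  since the estimates on the accumulated error do not depend on it.\<close>

definition glued :: "(nat \<Rightarrow> 'x) \<Rightarrow> nat \<Rightarrow> bool" where
  "glued z k \<longleftrightarrow> (\<forall>i\<le>k. z i \<in> X) \<and>
     (\<forall>i<k. \<forall>h\<in>carrier G. h \<otimes> inv (loc i) \<notin> A \<longrightarrow> dist (\<alpha> h (z (Suc i))) (\<alpha> h (z i)) \<le> \<epsilon>)"

text \<open>If \<open>h\<close> avoids the \<open>C\<close>-translates, then its whole window
  \<open>E h\<close> avoids the \<open>A\<close>-translates, because \<open>C\<close> absorbs every
  \<open>h\<close> with \<open>e \<otimes> h\<close> in \<open>A\<close>. Closeness
  \<open>2 * \<epsilon> \<le> c\<close> on the window then improves to \<open>\<epsilon>'\<close> at
  \<open>h\<close> itself.\<close>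

lemma window_improve:
  assumes uw: "u \<in> X" "w \<in> X" and h: "h \<in> carrier G" and "L \<subseteq> {..<m}"
    and close: "\<And>h. \<lbrakk>h \<in> carrier G; \<And>l. l \<in> L \<Longrightarrow> h \<otimes> inv (loc l) \<notin> A\<rbrakk> \<Longrightarrow>
                  dist (\<alpha> h u) (\<alpha> h w) \<le> 2 * \<epsilon>"
    and off: "\<And>l. l \<in> L \<Longrightarrow> h \<otimes> inv (loc l) \<notin> C"
  shows "dist (\<alpha> h u) (\<alpha> h w) < \<epsilon>'"
proof (rule window)
  fix e assume e: "e \<in> E"
  then have ec: "e \<in> carrier G" using E_sub by blast
  have "dist (\<alpha> (e \<otimes> h) u) (\<alpha> (e \<otimes> h) w) \<le> 2 * \<epsilon>"
  proof (rule close)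
    fix l assume l: "l \<in> L"
    then have lc: "loc l \<in> carrier G" using loc_carrier \<open>L \<subseteq> {..<m}\<close> by auto
    show "e \<otimes> h \<otimes> inv (loc l) \<notin> A"
      using C_E[of "h \<otimes> inv (loc l)" e] off[OF l] e ec h lc by (auto simp: m_assoc)
  qed (use ec h in auto)
  then show "dist (\<alpha> e (\<alpha> h u)) (\<alpha> e (\<alpha> h w)) \<le> c"
    using \<epsilon>_le uw ec h by (simp add: act_mult)
qed (use uw h in auto)

text \<open>The bound does not depend on the number of steps. The \<open>C\<close>-translates are
  disjoint, so at most one location \<open>l\<close> is near \<open>h\<close>; the links before and
  after \<open>l\<close> contribute less than \<open>\<epsilon>'\<close> each, and link
  \<open>l\<close> itself at most \<open>\<epsilon>\<close>. The induction is on the length of the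
  chain, for all \<open>h\<close> at once, because passing to the window replaces \<open>h\<close>
  by \<open>e \<otimes> h\<close>.\<close>

lemma glued_far:
  assumes "glued z k" "k \<le> m" "i \<le> j" "j \<le> k" "h \<in> carrier G"
    and "\<And>l. l \<in> {i..<j} \<Longrightarrow> h \<otimes> inv (loc l) \<notin> A"
  shows "dist (\<alpha> h (z j)) (\<alpha> h (z i)) \<le> 2 * \<epsilon>"
  using assms(3-6)
proof (induction "j - i" arbitrary: i j h rule: less_induct)
  case less
  have zX: "z l \<in> X" if "l \<le> k" for l using assms(1) that by (auto simp: glued_def)
  have step: "dist (\<alpha> h (z (Suc l))) (\<alpha> h (z l)) \<le> \<epsilon>" if "l \<in> {i..<j}" for l
    using assms(1) less.prems that by (auto simp: glued_def)
  have better: "dist (\<alpha> h (z q)) (\<alpha> h (z p)) < \<epsilon>'"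
    if pq: "p \<le> q" "q \<le> j" "q - p < j - i" and "\<And>l. l \<in> {p..<q} \<Longrightarrow> h \<otimes> inv (loc l) \<notin> C" for p q
  proof (rule window_improve[where L = "{p..<q}"])
    fix h' assume "h' \<in> carrier G" "\<And>l. l \<in> {p..<q} \<Longrightarrow> h' \<otimes> inv (loc l) \<notin> A"
    then show "dist (\<alpha> h' (z q)) (\<alpha> h' (z p)) \<le> 2 * \<epsilon>"
      using less.hyps[OF pq(3) pq(1) _ \<open>h' \<in> carrier G\<close>] pq less.prems by auto
  qed (use that less.prems \<open>k \<le> m\<close> zX in auto)
  show ?case
  proof (cases "i = j")
    case True
    then show ?thesis using \<epsilon>'_le \<epsilon>'_pos by simp
  next
    case False
    then have "i < j" using less.prems by simp
    \<comment> \<open>at most one location is near \<open>h\<close>; split the chain there, or at its last link if there is none\<close>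
    obtain l where l: "l \<in> {i..<j}" and
      other: "\<And>p. p \<in> {i..<j} \<Longrightarrow> p \<noteq> l \<Longrightarrow> h \<otimes> inv (loc p) \<notin> C"
    proof (cases "\<exists>l\<in>{i..<j}. h \<otimes> inv (loc l) \<in> C")
      case True
      then obtain l where l: "l \<in> {i..<j}" "h \<otimes> inv (loc l) \<in> C" by blast
      show ?thesis
      proof (rule that[OF l(1)])
        fix p assume "p \<in> {i..<j}" "p \<noteq> l"
        then show "h \<otimes> inv (loc p) \<notin> C"
          using l less.prems \<open>k \<le> m\<close> by (intro loc_disjoint[of l p]) auto
      qed
    next
      case False
      then show ?thesis using that[of "j - 1"] \<open>i < j\<close> by auto
    qed
    have "dist (\<alpha> h (z j)) (\<alpha> h (z (Suc l))) < \<epsilon>'"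
      by (rule better) (use l other in auto)
    moreover have "dist (\<alpha> h (z l)) (\<alpha> h (z i)) < \<epsilon>'"
      by (rule better) (use l other in auto)
    moreover note step[OF l]
    ultimately show ?thesis
      using \<epsilon>'_le dist_triangle[of "\<alpha> h (z j)" "\<alpha> h (z i)" "\<alpha> h (z (Suc l))"]
        dist_triangle[of "\<alpha> h (z (Suc l))" "\<alpha> h (z i)" "\<alpha> h (z l)"] by linarith
  qed
qed

lemma glued_very_far:
  assumes "glued z k" "k \<le> m" "i \<le> j" "j \<le> k" "h \<in> carrier G"
    and "\<And>l. l \<in> {i..<j} \<Longrightarrow> h \<otimes> inv (loc l) \<notin> C"
  shows "dist (\<alpha> h (z j)) (\<alpha> h (z i)) < \<epsilon>'"
proof (rule window_improve[where L = "{i..<j}"])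
  show "z j \<in> X" "z i \<in> X" using assms by (auto simp: glued_def)
  show "{i..<j} \<subseteq> {..<m}" using assms by auto
qed (use assms glued_far in auto)

text \<open>Step \<open>k\<close> applies the memory set to the target \<open>f k\<close> and to the
  current point translated by \<open>loc k\<close>. Earlier steps moved the orbit along
  \<open>B loc k\<close> by less than \<open>\<epsilon>'\<close>, which is the slack required in
  \<open>close\<close>.\<close>

lemma glued_exists:
  fixes f :: "nat \<Rightarrow> 'x"
  assumes memory: "memory_set G X \<alpha> \<epsilon> \<delta> A B" and BC: "B \<subseteq> C"
    and y: "y \<in> X" and f: "\<And>l. l < m \<Longrightarrow> f l \<in> X"
    and close: "\<And>l b. \<lbrakk>l < m; b \<in> B - A\<rbrakk> \<Longrightarrow> dist (\<alpha> b (f l)) (\<alpha> (b \<otimes> loc l) y) + \<epsilon>' \<le> \<delta>"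
    and "k \<le> m"
  shows "\<exists>z. z 0 = y \<and> glued z k \<and> (\<forall>l<k. \<forall>b\<in>B. dist (\<alpha> b (f l)) (\<alpha> (b \<otimes> loc l) (z (Suc l))) \<le> \<epsilon>)"
  using \<open>k \<le> m\<close>
proof (induction k)
  case 0
  then show ?case using y by (intro exI[of _ "\<lambda>_. y"]) (simp add: glued_def)
next
  case (Suc k)
  then obtain z where z: "z 0 = y" "glued z k"
    "\<And>l b. l < k \<Longrightarrow> b \<in> B \<Longrightarrow> dist (\<alpha> b (f l)) (\<alpha> (b \<otimes> loc l) (z (Suc l))) \<le> \<epsilon>" by auto
  have km: "k < m" using Suc.prems by simp
  have B: "B \<subseteq> carrier G" using memory by (simp add: memory_set_def)
  have lc: "loc k \<in> carrier G" using loc_carrier km by simp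
  have zX: "z k \<in> X" using z(2) by (simp add: glued_def)
  have nonneg: "0 \<le> \<epsilon>" using \<epsilon>'_le \<epsilon>'_pos by linarith
  have "dist_on \<alpha> (B - A) (f k) (\<alpha> (loc k) (z k)) \<le> ennreal \<delta>"
    unfolding dist_on_def
  proof (rule SUP_least, rule ennreal_leI)
    fix b assume b: "b \<in> B - A"
    then have bc: "b \<in> carrier G" using B by blast
    have "dist (\<alpha> (b \<otimes> loc k) (z k)) (\<alpha> (b \<otimes> loc k) (z 0)) < \<epsilon>'"
    proof (rule glued_very_far[OF z(2)])
      fix l assume "l \<in> {0..<k}"
      moreover have "b \<otimes> loc k \<otimes> inv (loc k) \<in> C"
        using b BC bc lc by (auto simp: m_assoc)
      ultimately show "b \<otimes> loc k \<otimes> inv (loc l) \<notin> C"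
        using loc_disjoint[of k l "b \<otimes> loc k"] km bc lc by auto
    qed (use km bc lc in auto)
    then have "dist (\<alpha> b (f k)) (\<alpha> (b \<otimes> loc k) (z k)) \<le> \<delta>"
      using close[OF km b] z(1) dist_triangle[of "\<alpha> b (f k)" "\<alpha> (b \<otimes> loc k) (z k)" "\<alpha> (b \<otimes> loc k) y"]
      by (simp add: dist_commute)
    then show "dist (\<alpha> b (f k)) (\<alpha> b (\<alpha> (loc k) (z k))) \<le> \<delta>"
      using bc lc zX by (simp add: act_mult)
  qed
  then obtain w where w: "w \<in> X" "dist_on \<alpha> B (f k) w \<le> ennreal \<epsilon>"
    "dist_on \<alpha> (carrier G - A) (\<alpha> (loc k) (z k)) w \<le> ennreal \<epsilon>"
    using memory f[OF km] act_closed[OF lc zX] unfolding memory_set_def by blast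
  \<comment> \<open>The memory set acts at the identity; translating back by
    \<open>inv (loc k)\<close> puts the change at the location \<open>loc k\<close>.\<close>
  define w' where "w' = \<alpha> (inv (loc k)) w"
  have w'X: "w' \<in> X" using w lc by (simp add: w'_def)
  have lw: "\<alpha> (loc k) w' = w" using w lc by (simp add: w'_def act_mult)
  have near: "dist (\<alpha> b (f k)) (\<alpha> (b \<otimes> loc k) w') \<le> \<epsilon>" if "b \<in> B" for b
  proof -
    have "ennreal (dist (\<alpha> b (f k)) (\<alpha> b w)) \<le> ennreal \<epsilon>"
      using w(2) that unfolding dist_on_def by (simp add: SUP_le_iff)
    moreover have "\<alpha> b w = \<alpha> (b \<otimes> loc k) w'"
      using lw that B lc w'X by (metis act_mult subsetD)
    ultimately show ?thesis using nonneg by simp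
  qed
  have far: "dist (\<alpha> h w') (\<alpha> h (z k)) \<le> \<epsilon>" if h: "h \<in> carrier G" "h \<otimes> inv (loc k) \<notin> A" for h
  proof -
    let ?h = "h \<otimes> inv (loc k)"
    have "ennreal (dist (\<alpha> ?h (\<alpha> (loc k) (z k))) (\<alpha> ?h w)) \<le> ennreal \<epsilon>"
      using w(3) h lc unfolding dist_on_def by (simp add: SUP_le_iff)
    moreover have "\<alpha> ?h w = \<alpha> h w'"
      using w h lc by (simp add: w'_def act_mult)
    moreover have "\<alpha> ?h (\<alpha> (loc k) (z k)) = \<alpha> h (z k)"
      using zX h lc by (simp add: act_mult m_assoc)
    ultimately show ?thesis using nonneg by (simp add: dist_commute)
  qed
  show ?case
  proof (intro exI[of _ "z(Suc k := w')"] conjI allI impI ballI)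
    show "glued (z(Suc k := w')) (Suc k)"
      using z(2) w'X far by (auto simp: glued_def less_Suc_eq le_Suc_eq)
    fix l b assume "l < Suc k" "b \<in> B"
    then show "dist (\<alpha> b (f l)) (\<alpha> (b \<otimes> loc l) ((z(Suc k := w')) (Suc l))) \<le> \<epsilon>"
      using z(3) near by (auto simp: less_Suc_eq)
  qed (use z(1) in auto)
qed

lemma gluing_exists:
  fixes f :: "nat \<Rightarrow> 'x"
  assumes memory: "memory_set G X \<alpha> \<epsilon> \<delta> A B" and BC: "B \<subseteq> C"
    and y: "y \<in> X" and f: "\<And>l. l < m \<Longrightarrow> f l \<in> X"
    and close: "\<And>l b. \<lbrakk>l < m; b \<in> B - A\<rbrakk> \<Longrightarrow> dist (\<alpha> b (f l)) (\<alpha> (b \<otimes> loc l) y) + \<epsilon>' \<le> \<delta>"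
  obtains z where "z \<in> X"
    "\<And>h. \<lbrakk>h \<in> carrier G; \<And>l. l < m \<Longrightarrow> h \<otimes> inv (loc l) \<notin> A\<rbrakk> \<Longrightarrow> dist (\<alpha> h z) (\<alpha> h y) \<le> 2 * \<epsilon>"
    "\<And>l b. \<lbrakk>l < m; b \<in> B\<rbrakk> \<Longrightarrow> dist (\<alpha> b (f l)) (\<alpha> (b \<otimes> loc l) z) \<le> \<epsilon> + \<epsilon>'"
proof -
  from glued_exists[OF memory BC y f close order_refl]
  obtain z where z: "z 0 = y" "glued z m"
    "\<And>l b. \<lbrakk>l < m; b \<in> B\<rbrakk> \<Longrightarrow> dist (\<alpha> b (f l)) (\<alpha> (b \<otimes> loc l) (z (Suc l))) \<le> \<epsilon>" by blast
  show thesis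
  proof (rule that)
    show "z m \<in> X" using z(2) by (simp add: glued_def)
    show "dist (\<alpha> h (z m)) (\<alpha> h y) \<le> 2 * \<epsilon>"
      if "h \<in> carrier G" "\<And>l. l < m \<Longrightarrow> h \<otimes> inv (loc l) \<notin> A" for h
      using glued_far[OF z(2) order_refl _ order_refl that(1), of 0] that(2) z(1) by auto
    fix l b assume lb: "l < m" "b \<in> B"
    have bc: "b \<in> carrier G" "loc l \<in> carrier G"
      using memory lb loc_carrier by (auto simp: memory_set_def)
    \<comment> \<open>The steps after \<open>l\<close> take place at other locations, so what was
      arranged along \<open>B loc l\<close> at step \<open>l\<close> survives up to
      \<open>\<epsilon>'\<close>.\<close>
    have "dist (\<alpha> (b \<otimes> loc l) (z m)) (\<alpha> (b \<otimes> loc l) (z (Suc l))) < \<epsilon>'"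
    proof (rule glued_very_far[OF z(2)])
      fix p assume "p \<in> {Suc l..<m}"
      moreover have "b \<otimes> loc l \<otimes> inv (loc l) \<in> C"
        using lb BC bc by (auto simp: m_assoc)
      ultimately show "b \<otimes> loc l \<otimes> inv (loc p) \<notin> C"
        using loc_disjoint[of l p "b \<otimes> loc l"] lb bc by auto
    qed (use lb bc in auto)
    then show "dist (\<alpha> b (f l)) (\<alpha> (b \<otimes> loc l) (z m)) \<le> \<epsilon> + \<epsilon>'"
      using z(3)[OF lb] dist_triangle[of "\<alpha> b (f l)" "\<alpha> (b \<otimes> loc l) (z m)" "\<alpha> (b \<otimes> loc l) (z (Suc l))"]
      by (simp add: dist_commute)
  qed
qed

end

section \<open>Sofic models: good vertices and independent subsets\<close>

text \<open>Join \<open>a\<close> to \<open>\<tau> t a\<close> for all \<open>t\<close> in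
  \<open>T\<close>. A maximal independent set \<open>I\<close> in this graph dominates
  \<open>J\<close>: every vertex lies in \<open>I\<close> or in one of the \<open>card T\<close>
  images of \<open>I\<close>, which gives the cardinality estimate.\<close>

lemma independent_subset_exists:
  fixes \<tau> :: "'t \<Rightarrow> 'v \<Rightarrow> 'v"
  assumes "finite J" "finite T"
    and sym: "\<And>a t. \<lbrakk>a \<in> J; t \<in> T; \<tau> t a \<in> J\<rbrakk> \<Longrightarrow> \<exists>t'\<in>T. \<tau> t' (\<tau> t a) = a"
  shows "\<exists>J'\<subseteq>J. (\<forall>a\<in>J'. \<forall>b\<in>J'. \<forall>t\<in>T. a \<noteq> b \<longrightarrow> \<tau> t a \<noteq> b) \<and> card J \<le> (card T + 1) * card J'"
proof -
  define ind where "ind I \<longleftrightarrow> I \<subseteq> J \<and> (\<forall>a\<in>I. \<forall>b\<in>I. \<forall>t\<in>T. a \<noteq> b \<longrightarrow> \<tau> t a \<noteq> b)" for I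
  have "finite {I. ind I}"
    by (rule finite_subset[of _ "Pow J"]) (use \<open>finite J\<close> in \<open>auto simp: ind_def\<close>)
  moreover have "{} \<in> {I. ind I}" by (simp add: ind_def)
  ultimately obtain I where I: "ind I" "\<And>I'. ind I' \<Longrightarrow> I \<subseteq> I' \<Longrightarrow> I' = I"
    using finite_has_maximal2[of "{I. ind I}" "{}"] by auto
  have fI: "finite I" using I(1) \<open>finite J\<close> finite_subset by (auto simp: ind_def)
  have "J \<subseteq> I \<union> (\<Union>t\<in>T. \<tau> t ` I)"
  proof
    fix a assume a: "a \<in> J"
    show "a \<in> I \<union> (\<Union>t\<in>T. \<tau> t ` I)"
    proof (rule ccontr)
      assume na: "a \<notin> I \<union> (\<Union>t\<in>T. \<tau> t ` I)"
      \<comment> \<open>An uncovered \<open>a\<close> could be added to \<open>I\<close>: edges from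
        \<open>I\<close> to \<open>a\<close> are excluded by \<open>na\<close>, and edges from
        \<open>a\<close> to \<open>I\<close> can be reversed by \<open>sym\<close>.\<close>
      have "ind (insert a I)"
        unfolding ind_def
      proof (intro conjI ballI impI)
        show "insert a I \<subseteq> J" using a I(1) by (auto simp: ind_def)
        fix u w t assume uw: "u \<in> insert a I" "w \<in> insert a I" and t: "t \<in> T" and "u \<noteq> w"
        show "\<tau> t u \<noteq> w"
        proof
          assume eq: "\<tau> t u = w"
          consider "u \<in> I" "w \<in> I" | "u = a" "w \<in> I" | "u \<in> I" "w = a"
            using uw \<open>u \<noteq> w\<close> by auto
          then show False
          proof cases
            case 1
            then show False using I(1) t \<open>u \<noteq> w\<close> eq by (auto simp: ind_def)
          next
            case 2
            then have "w \<in> J" using I(1) by (auto simp: ind_def)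
            then obtain t' where "t' \<in> T" "\<tau> t' w = a" using sym[OF a t] eq 2 by auto
            then show False using na 2 by auto
          next
            case 3
            then show False using na t eq by auto
          qed
        qed
      qed
      then show False using I(2)[of "insert a I"] na by auto
    qed
  qed
  then have "card J \<le> card (I \<union> (\<Union>t\<in>T. \<tau> t ` I))"
    using fI \<open>finite T\<close> by (intro card_mono) auto
  also have "\<dots> \<le> card I + card (\<Union>t\<in>T. \<tau> t ` I)" by (rule card_Un_le)
  also have "card (\<Union>t\<in>T. \<tau> t ` I) \<le> (\<Sum>t\<in>T. card (\<tau> t ` I))"
    by (rule card_UN_le[OF \<open>finite T\<close>])
  also have "\<dots> \<le> (\<Sum>t\<in>T. card I)" by (intro sum_mono card_image_le[OF fI])
  finally have "card J \<le> (card T + 1) * card I" by simp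
  then show ?thesis using I(1) by (intro exI[of _ I] conjI) (simp_all add: ind_def)
qed

section \<open>Vertices at which the sofic map looks like a free action, and at which a model is
  equivariant\<close>

definition sofic_good ::
  "('g, 'm) monoid_scheme \<Rightarrow> 'g set \<Rightarrow> ('g \<Rightarrow> nat \<Rightarrow> nat) \<Rightarrow> nat \<Rightarrow> bool" where
  "sofic_good G P s v \<longleftrightarrow>
     (\<forall>g\<in>P. \<forall>h\<in>P. s (g \<otimes>\<^bsub>G\<^esub> h) v = s g (s h v) \<and> (g \<noteq> h \<longrightarrow> s g v \<noteq> s h v))"

lemma eventually_card_complement_le:
  fixes n :: "nat \<Rightarrow> nat"
  assumes "\<And>i. n i > 0" "\<kappa> > 0"
    and "(\<lambda>i. real (card {v\<in>{1..n i}. Q i v}) / real (n i)) \<longlonglongrightarrow> 1"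
  shows "\<forall>\<^sub>F i in sequentially. real (card {v\<in>{1..n i}. \<not> Q i v}) \<le> \<kappa> * real (n i)"
proof -
  have "\<forall>\<^sub>F i in sequentially. real (card {v\<in>{1..n i}. Q i v}) / real (n i) > 1 - \<kappa>"
    using assms(2) by (intro order_tendstoD(1)[OF assms(3)]) simp
  then show ?thesis
  proof eventually_elim
    case (elim i)
    have "{v\<in>{1..n i}. Q i v} \<union> {v\<in>{1..n i}. \<not> Q i v} = {1..n i}" by auto
    then have "card {v\<in>{1..n i}. Q i v} + card {v\<in>{1..n i}. \<not> Q i v} = card {1..n i}"
      by (subst card_Un_disjoint[symmetric]) auto
    then have "real (card {v\<in>{1..n i}. Q i v}) + real (card {v\<in>{1..n i}. \<not> Q i v}) = real (n i)"
      by (metis card_atLeastAtMost diff_Suc_1 of_nat_add)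
    then show ?case using elim assms(1)[of i] by (simp add: field_simps)
  qed
qed

text \<open>A union bound over the finitely many pairs in \<open>P \<times> P\<close>, each with an
  exceptional set of vanishing proportion.\<close>

lemma eventually_sofic_good:
  assumes "sofic_approximation G n \<sigma>" "finite P" "P \<subseteq> carrier G" "\<beta> > 0"
  shows "\<forall>\<^sub>F i in sequentially.
           real (card {v\<in>{1..n i}. \<not> sofic_good G P (\<sigma> i) v}) \<le> \<beta> * real (n i)"
proof -
  define bad where "bad i p = {v\<in>{1..n i}. \<not> \<sigma> i (fst p \<otimes>\<^bsub>G\<^esub> snd p) v = \<sigma> i (fst p) (\<sigma> i (snd p) v)} \<union>
    {v\<in>{1..n i}. fst p \<noteq> snd p \<and> \<not> \<sigma> i (fst p) v \<noteq> \<sigma> i (snd p) v}" for i p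
  \<comment> \<open>The factor 2 accounts for the two ways in which a pair can fail,
    multiplicativity and freeness; the summand 1 keeps the denominator positive when
    \<open>P\<close> is empty.\<close>
  define \<kappa> where "\<kappa> = \<beta> / (2 * (card (P \<times> P) + 1))"
  have \<kappa>: "\<kappa> > 0" using assms(4) by (simp add: \<kappa>_def add_nonneg_pos)
  have n: "n i > 0" for i using assms(1) by (simp add: sofic_approximation_def)
  have "\<forall>\<^sub>F i in sequentially. real (card (bad i p)) \<le> 2 * \<kappa> * real (n i)" if p: "p \<in> P \<times> P" for p
  proof -
    have pc: "fst p \<in> carrier G" "snd p \<in> carrier G" using p assms(3) by auto
    have 1: "\<forall>\<^sub>F i in sequentially. real (card {v\<in>{1..n i}.
        \<not> \<sigma> i (fst p \<otimes>\<^bsub>G\<^esub> snd p) v = \<sigma> i (fst p) (\<sigma> i (snd p) v)}) \<le> \<kappa> * real (n i)"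
      using assms(1) pc n \<kappa> by (intro eventually_card_complement_le) (auto simp: sofic_approximation_def)
    have 2: "\<forall>\<^sub>F i in sequentially. real (card {v\<in>{1..n i}.
        fst p \<noteq> snd p \<and> \<not> \<sigma> i (fst p) v \<noteq> \<sigma> i (snd p) v}) \<le> \<kappa> * real (n i)"
    proof (cases "fst p = snd p")
      case True
      then show ?thesis using \<kappa> by simp
    next
      case False
      have "\<forall>\<^sub>F i in sequentially. real (card {v\<in>{1..n i}.
        \<not> \<sigma> i (fst p) v \<noteq> \<sigma> i (snd p) v}) \<le> \<kappa> * real (n i)"
        using assms(1) pc n \<kappa> False
        by (intro eventually_card_complement_le) (auto simp: sofic_approximation_def)
      then show ?thesis using False by simp
    qed
    from 1 2 show ?thesis
    proof eventually_elim
      case (elim i)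
      have "real (card (bad i p)) \<le> real (card {v\<in>{1..n i}.
        \<not> \<sigma> i (fst p \<otimes>\<^bsub>G\<^esub> snd p) v = \<sigma> i (fst p) (\<sigma> i (snd p) v)}) + real (card {v\<in>{1..n i}.
        fst p \<noteq> snd p \<and> \<not> \<sigma> i (fst p) v \<noteq> \<sigma> i (snd p) v})"
        unfolding bad_def of_nat_add[symmetric] of_nat_le_iff by (rule card_Un_le)
      then show ?case using elim by linarith
    qed
  qed
  then have "\<forall>\<^sub>F i in sequentially. \<forall>p\<in>P \<times> P. real (card (bad i p)) \<le> 2 * \<kappa> * real (n i)"
    using assms(2) by (intro eventually_ball_finite) auto
  then show ?thesis
  proof eventually_elim
    case (elim i)
    have "{v\<in>{1..n i}. \<not> sofic_good G P (\<sigma> i) v} \<subseteq> (\<Union>p\<in>P \<times> P. bad i p)"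
      by (auto simp: sofic_good_def bad_def)
    then have "card {v\<in>{1..n i}. \<not> sofic_good G P (\<sigma> i) v} \<le> card (\<Union>p\<in>P \<times> P. bad i p)"
      using assms(2) by (intro card_mono) (auto simp: bad_def)
    also have "\<dots> \<le> (\<Sum>p\<in>P \<times> P. card (bad i p))"
      using assms(2) by (intro card_UN_le) auto
    finally have "real (card {v\<in>{1..n i}. \<not> sofic_good G P (\<sigma> i) v}) \<le> (\<Sum>p\<in>P \<times> P. real (card (bad i p)))"
      by (simp only: of_nat_sum[symmetric] of_nat_le_iff)
    also have "\<dots> \<le> real (card (P \<times> P)) * (2 * \<kappa> * real (n i))"
      using elim by (intro sum_bounded_above) auto
    also have "\<dots> \<le> \<beta> * real (n i)"
    proof -
      have "real (card (P \<times> P)) * (2 * \<kappa>) \<le> \<beta>"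
        using assms(4) unfolding \<kappa>_def by (simp add: field_simps)
      from mult_right_mono[OF this, of "real (n i)"] show ?thesis by (simp add: mult.assoc)
    qed
    finally show ?case .
  qed
qed

text \<open>Chebyshev's inequality: the mean square bound limits the proportion of vertices with a
  large defect.\<close>

lemma sofic_Map_card_far:
  assumes "\<phi> \<in> sofic_Map X \<alpha> F \<delta> N s" "g \<in> F" "\<eta> > 0" "N > 0"
  shows "real (card {v\<in>{1..N}. dist (\<phi> (s g v)) (\<alpha> g (\<phi> v)) > \<eta>}) \<le> (\<delta> / \<eta>)\<^sup>2 * real N"
proof -
  let ?d = "\<lambda>v. dist (\<phi> (s g v)) (\<alpha> g (\<phi> v))"
  let ?S = "{v\<in>{1..N}. ?d v > \<eta>}"
  have "sqrt (1 / real N * (\<Sum>v=1..N. (?d v)\<^sup>2)) \<le> \<delta>"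
    using assms(1,2) by (simp add: sofic_Map_def)
  then have le: "1 / real N * (\<Sum>v=1..N. (?d v)\<^sup>2) \<le> \<delta>\<^sup>2" by (rule sqrt_le_D)
  have "real (card ?S) * \<eta>\<^sup>2 \<le> (\<Sum>v\<in>?S. (?d v)\<^sup>2)"
    using assms(3) by (intro sum_bounded_below) (auto intro!: power_mono)
  also have "\<dots> \<le> (\<Sum>v=1..N. (?d v)\<^sup>2)" by (intro sum_mono2) auto
  also have "\<dots> \<le> \<delta>\<^sup>2 * real N" using le assms(4) by (simp add: field_simps)
  finally show ?thesis using assms(3) by (simp add: field_simps power_divide)
qed

lemma sofic_Map_mostly_equivariant:
  assumes "finite P" "\<beta> > 0" "\<eta> > 0"
  shows "\<exists>\<delta>>0. \<forall>N s \<phi>. N > 0 \<and> \<phi> \<in> sofic_Map X \<alpha> P \<delta> N s \<longrightarrow>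
    real (card {v\<in>{1..N}. \<exists>g\<in>P. dist (\<phi> (s g v)) (\<alpha> g (\<phi> v)) > \<eta>}) \<le> \<beta> * real N"
\<comment> \<open>With this choice Chebyshev's bound for a single \<open>g\<close> is exactly
  \<open>\<beta> / (card P + 1)\<close>, and a union bound over \<open>P\<close> suffices.\<close>
proof (intro exI[of _ "\<eta> * sqrt (\<beta> / (card P + 1))"] conjI allI impI)
  let ?\<delta> = "\<eta> * sqrt (\<beta> / (card P + 1))"
  show "?\<delta> > 0" using assms by (simp add: add_nonneg_pos)
  fix N s \<phi> assume "N > 0 \<and> \<phi> \<in> sofic_Map X \<alpha> P ?\<delta> N s"
  then have \<phi>: "\<phi> \<in> sofic_Map X \<alpha> P ?\<delta> N s" and "N > 0" by auto
  let ?S = "\<lambda>g. {v\<in>{1..N}. dist (\<phi> (s g v)) (\<alpha> g (\<phi> v)) > \<eta>}"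
  have "{v\<in>{1..N}. \<exists>g\<in>P. dist (\<phi> (s g v)) (\<alpha> g (\<phi> v)) > \<eta>} = (\<Union>g\<in>P. ?S g)" by auto
  then have "card {v\<in>{1..N}. \<exists>g\<in>P. dist (\<phi> (s g v)) (\<alpha> g (\<phi> v)) > \<eta>} \<le> (\<Sum>g\<in>P. card (?S g))"
    using card_UN_le[OF assms(1), of ?S] by simp
  then have "real (card {v\<in>{1..N}. \<exists>g\<in>P. dist (\<phi> (s g v)) (\<alpha> g (\<phi> v)) > \<eta>}) \<le> (\<Sum>g\<in>P. real (card (?S g)))"
    by (simp only: of_nat_sum[symmetric] of_nat_le_iff)
  also have "\<dots> \<le> real (card P) * ((?\<delta> / \<eta>)\<^sup>2 * real N)"
    using sofic_Map_card_far[OF \<phi> _ assms(3) \<open>N > 0\<close>] by (intro sum_bounded_above) auto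
  also have "(?\<delta> / \<eta>)\<^sup>2 = \<beta> / (card P + 1)"
    using assms by (simp add: add_nonneg_pos)
  also have "real (card P) * (\<beta> / (card P + 1) * real N) \<le> \<beta> * real N"
    using assms by (simp add: field_simps)
  finally show "real (card {v\<in>{1..N}. \<exists>g\<in>P. dist (\<phi> (s g v)) (\<alpha> g (\<phi> v)) > \<eta>}) \<le> \<beta> * real N" .
qed

section \<open>Repairing a model at marked vertices\<close>

lemma (in group) finite_quotient_set:
  assumes "finite E" "E \<subseteq> carrier G" "finite A"
  shows "finite {h \<in> carrier G. \<exists>e\<in>E. e \<otimes> h \<in> A}"
proof (rule finite_subset)
  show "{h \<in> carrier G. \<exists>e\<in>E. e \<otimes> h \<in> A} \<subseteq> (\<lambda>(e, a). inv e \<otimes> a) ` (E \<times> A)"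
  proof
    fix h assume "h \<in> {h \<in> carrier G. \<exists>e\<in>E. e \<otimes> h \<in> A}"
    then obtain e where e: "h \<in> carrier G" "e \<in> E" "e \<otimes> h \<in> A" by auto
    then have "h = inv e \<otimes> (e \<otimes> h)" using assms(2) by (auto simp: m_assoc[symmetric])
    then show "h \<in> (\<lambda>(e, a). inv e \<otimes> a) ` (E \<times> A)" using e by force
  qed
qed (use assms in simp)

text \<open>A sofic approximation need not send the identity to the identity permutation. At a good
  vertex \<open>s \<one>\<close> is idempotent, and injectivity cancels one factor.\<close>

lemma (in group) sofic_good_one:
  assumes "sofic_good G P s v" "\<one> \<in> P" "inj (s \<one>)"
  shows "s \<one> v = v"
proof -
  have "s (\<one> \<otimes> \<one>) v = s \<one> (s \<one> v)" using assms(1,2) unfolding sofic_good_def by blast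
  then show ?thesis using assms(3) by (simp add: inj_eq)
qed

text \<open>The sequential construction, freed from its order: the finite set \<open>L\<close> of
  locations is enumerated arbitrarily, and the resulting bounds mention no enumeration.\<close>

lemma (in expansive_action) gluing_finite_set:
  fixes f :: "'g \<Rightarrow> 'x"
  assumes eps: "2 * \<epsilon> \<le> c" "2 * \<epsilon>' \<le> \<epsilon>" "0 \<le> \<epsilon>'"
    and window: "\<And>u w. \<lbrakk>u \<in> X; w \<in> X; \<And>g. g \<in> E \<Longrightarrow> dist (\<alpha> g u) (\<alpha> g w) \<le> c\<rbrakk> \<Longrightarrow> dist u w < \<epsilon>'"
    and E_sub: "E \<subseteq> carrier G"
    and C_E: "\<And>h e. \<lbrakk>h \<in> carrier G; e \<in> E; e \<otimes> h \<in> A\<rbrakk> \<Longrightarrow> h \<in> C"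
    and memory: "memory_set G X \<alpha> \<epsilon> \<delta> A B" and BC: "B \<subseteq> C"
    and L: "finite L" "L \<subseteq> carrier G"
    and disjoint: "\<And>g g' h. \<lbrakk>g \<in> L; g' \<in> L; g \<noteq> g'; h \<in> carrier G; h \<otimes> inv g \<in> C\<rbrakk> \<Longrightarrow> h \<otimes> inv g' \<notin> C"
    and y: "y \<in> X" and f: "\<And>g. g \<in> L \<Longrightarrow> f g \<in> X"
    and close: "\<And>g b. \<lbrakk>g \<in> L; b \<in> B - A\<rbrakk> \<Longrightarrow> dist (\<alpha> b (f g)) (\<alpha> (b \<otimes> g) y) + \<epsilon>' \<le> \<delta>"
  obtains z where "z \<in> X"
    "\<And>h. \<lbrakk>h \<in> carrier G; \<And>g. g \<in> L \<Longrightarrow> h \<otimes> inv g \<notin> A\<rbrakk> \<Longrightarrow> dist (\<alpha> h z) (\<alpha> h y) \<le> 2 * \<epsilon>"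
    "\<And>g b. \<lbrakk>g \<in> L; b \<in> B\<rbrakk> \<Longrightarrow> dist (\<alpha> b (f g)) (\<alpha> (b \<otimes> g) z) \<le> \<epsilon> + \<epsilon>'"
proof -
  obtain loc where loc: "bij_betw loc {0..<card L} L"
    using ex_bij_betw_nat_finite[OF L(1)] by blast
  then have locL: "loc l \<in> L" if "l < card L" for l
    using that bij_betwE by fastforce
  have inj: "loc l \<noteq> loc p" if "l < card L" "p < card L" "l \<noteq> p" for l p
    using that loc by (auto simp: bij_betw_def inj_on_def)
  interpret gluing G X \<alpha> c \<epsilon> \<epsilon>' A E C loc "card L"
  proof unfold_locales
    fix l p h
    assume "l < card L" "p < card L" "l \<noteq> p" "h \<in> carrier G" "h \<otimes> inv (loc l) \<in> C"
    then show "h \<otimes> inv (loc p) \<notin> C" using disjoint[of "loc l" "loc p" h] locL inj by blast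
  qed (use eps window E_sub C_E L locL in auto)
  obtain z where z: "z \<in> X"
    "\<And>h. \<lbrakk>h \<in> carrier G; \<And>l. l < card L \<Longrightarrow> h \<otimes> inv (loc l) \<notin> A\<rbrakk> \<Longrightarrow> dist (\<alpha> h z) (\<alpha> h y) \<le> 2 * \<epsilon>"
    "\<And>l b. \<lbrakk>l < card L; b \<in> B\<rbrakk> \<Longrightarrow> dist (\<alpha> b (f (loc l))) (\<alpha> (b \<otimes> loc l) z) \<le> \<epsilon> + \<epsilon>'"
    using gluing_exists[OF memory BC y, of "\<lambda>l. f (loc l)"] f close locL by auto
  show thesis
  proof (rule that[OF z(1)])
    show "dist (\<alpha> h z) (\<alpha> h y) \<le> 2 * \<epsilon>"
      if "h \<in> carrier G" "\<And>g. g \<in> L \<Longrightarrow> h \<otimes> inv g \<notin> A" for h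
      using z(2) that locL by blast
    fix g b assume "g \<in> L" "b \<in> B"
    moreover obtain l where "l < card L" "g = loc l"
      using loc \<open>g \<in> L\<close> unfolding bij_betw_def by (metis atLeastLessThan_iff imageE)
    ultimately show "dist (\<alpha> b (f g)) (\<alpha> (b \<otimes> g) z) \<le> \<epsilon> + \<epsilon>'"
      using z(3) by blast
  qed
qed

definition model_good ::
  "('g, 'm) monoid_scheme \<Rightarrow> ('g \<Rightarrow> 'x::metric_space \<Rightarrow> 'x) \<Rightarrow> 'g set \<Rightarrow> real \<Rightarrow> nat \<Rightarrow>
    ('g \<Rightarrow> nat \<Rightarrow> nat) \<Rightarrow> (nat \<Rightarrow> 'x) \<Rightarrow> nat \<Rightarrow> bool" where
  "model_good G \<alpha> P \<eta> N s \<phi> v \<longleftrightarrow>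
     v \<in> {1..N} \<and> sofic_good G P s v \<and> (\<forall>g\<in>P. dist (\<phi> (s g v)) (\<alpha> g (\<phi> v)) \<le> \<eta>)"

text \<open>
  An orbit that follows \<open>x\<close> along \<open>B \<otimes> g\<close> can be changed at the location \<open>g\<close> to follow
  any point asymptotic to \<open>x\<close> off \<open>A\<close>; such changes at different locations do not interfere when
  the translates of \<open>influence\<close> to these locations are disjoint.
\<close>

locale marking = expansive_action G X \<alpha> c
  for G :: "('g, 'm) monoid_scheme" (structure) and X :: "'x::metric_space set" and \<alpha> and c +
  fixes \<epsilon> \<epsilon>' \<delta> :: real and A B E :: "'g set" and x :: 'x
  assumes eps: "5 * \<epsilon> \<le> c" "0 < \<epsilon>'" "2 * \<epsilon>' \<le> \<epsilon>" "4 * \<epsilon>' \<le> \<delta>"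
    and window: "\<lbrakk>u \<in> X; w \<in> X; \<And>g. g \<in> E \<Longrightarrow> dist (\<alpha> g u) (\<alpha> g w) \<le> c\<rbrakk> \<Longrightarrow> dist u w < \<epsilon>'"
    and E: "finite E" "E \<subseteq> carrier G"
    and one_A: "\<one> \<in> A"
    and memory: "memory_set G X \<alpha> \<epsilon> \<delta> A B"
    and x: "x \<in> X"
begin

text \<open>This serves as the set \<open>C\<close> of the gluing: \<open>B\<close>, where the
  change is compared with its target, together with all elements whose window \<open>E\<close> meets
  \<open>A\<close>.\<close>

definition influence :: "'g set" where
  "influence = B \<union> {h \<in> carrier G. \<exists>e\<in>E. e \<otimes> h \<in> A}"

text \<open>If the translates of \<open>influence\<close> to two distinct locations \<open>g\<close>
  and \<open>g'\<close> meet, then \<open>g' \<otimes> inv g\<close> lies in this set. Being finite,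
  it bounds the degree of the graph in which marked vertices must be independent.\<close>

definition conflicts :: "'g set" where
  "conflicts = {inv h \<otimes> h' | h h'. h \<in> influence \<and> h' \<in> influence} - {\<one>}"

lemma AB: "A \<subseteq> B" "B \<subseteq> carrier G" "finite B" "A \<subseteq> carrier G" "finite A"
  using memory finite_subset unfolding memory_set_def by auto

lemma influence: "finite influence" "influence \<subseteq> carrier G"
  using AB E finite_quotient_set[of E A] by (auto simp: influence_def)

lemma conflicts: "finite conflicts" "conflicts \<subseteq> carrier G"
proof -
  have "conflicts \<subseteq> (\<lambda>(h, h'). inv h \<otimes> h') ` (influence \<times> influence)"
    by (auto simp: conflicts_def)
  then show "finite conflicts" using influence(1) finite_subset by blast
  show "conflicts \<subseteq> carrier G" using influence(2) by (auto simp: conflicts_def)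
qed

lemma conflicts_inv: "t \<in> conflicts \<Longrightarrow> inv t \<in> conflicts"
proof -
  assume "t \<in> conflicts"
  then obtain h h' where h: "t = inv h \<otimes> h'" "h \<in> influence" "h' \<in> influence" "t \<noteq> \<one>"
    by (auto simp: conflicts_def)
  then have hc: "h \<in> carrier G" "h' \<in> carrier G" using influence(2) by auto
  have "inv t = inv h' \<otimes> h" using h(1) hc by (simp add: inv_mult_group)
  moreover have "inv t \<noteq> \<one>" using h(1,4) hc by (metis inv_eq_1_iff m_closed inv_closed)
  ultimately show "inv t \<in> conflicts" using h by (auto simp: conflicts_def)
qed

end

text \<open>At each marked vertex \<open>a\<close> in \<open>J\<close> the model
  \<open>\<phi>\<close> is near \<open>x\<close> and is to be redirected to \<open>f a\<close>.
  Equivariance is wanted along \<open>F\<close> and will be tested on the window \<open>H\<close>;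
  \<open>W\<close> contains the products \<open>inv k \<otimes> h\<close> and
  \<open>inv k \<otimes> h \<otimes> g\<close>, so neighbouring vertices see the same marks where
  the test takes place. \<open>P\<close> collects all elements at which good vertices must behave
  well.\<close>

locale repair = marking G X \<alpha> c \<epsilon> \<epsilon>' \<delta> A B E x
  for G :: "('g, 'm) monoid_scheme" (structure) and X :: "'x::metric_space set" and \<alpha> and c
    and \<epsilon> \<epsilon>' \<delta> A B E x +
  fixes N :: nat and s :: "'g \<Rightarrow> nat \<Rightarrow> nat" and \<phi> :: "nat \<Rightarrow> 'x"
    and F H W P :: "'g set" and \<eta> :: real and J :: "nat set" and f :: "nat \<Rightarrow> 'x"
  assumes P: "P \<subseteq> carrier G" "F \<subseteq> P" "W \<subseteq> P" "conflicts \<subseteq> P"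
    and H: "H \<subseteq> carrier G"
    and W: "finite W" "\<one> \<in> W" "\<lbrakk>k \<in> A; h \<in> H\<rbrakk> \<Longrightarrow> inv k \<otimes> h \<in> W"
      "\<lbrakk>k \<in> A; h \<in> H; g \<in> F\<rbrakk> \<Longrightarrow> inv k \<otimes> h \<otimes> g \<in> W"
    and perm: "g \<in> P \<Longrightarrow> s g permutes {1..N}"
    and \<phi>: "v \<in> {1..N} \<Longrightarrow> \<phi> v \<in> X"
    and equicontinuous: "\<lbrakk>u \<in> X; w \<in> X; dist u w \<le> \<eta>; b \<in> B \<union> H\<rbrakk> \<Longrightarrow>
      dist (\<alpha> b u) (\<alpha> b w) \<le> min \<epsilon> (\<delta> / 8)"
    and J_good: "a \<in> J \<Longrightarrow> model_good G \<alpha> P \<eta> N s \<phi> a"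
    and J_indep: "\<lbrakk>a \<in> J; a' \<in> J; t \<in> conflicts; a \<noteq> a'\<rbrakk> \<Longrightarrow> s t a \<noteq> a'"
    and J_near: "\<lbrakk>a \<in> J; b \<in> B\<rbrakk> \<Longrightarrow> dist (\<alpha> b (\<phi> a)) (\<alpha> b x) \<le> \<delta> / 8"
    and f: "a \<in> J \<Longrightarrow> f a \<in> X"
    and f_near: "\<lbrakk>a \<in> J; b \<in> B - A\<rbrakk> \<Longrightarrow> dist (\<alpha> b (f a)) (\<alpha> b x) \<le> \<delta> / 2"
begin

abbreviation good :: "nat \<Rightarrow> bool" where
  "good \<equiv> model_good G \<alpha> P \<eta> N s \<phi>"

text \<open>Seen from \<open>v\<close>, the marked vertex \<open>s g v\<close> becomes the location
  \<open>g\<close> in the orbit of \<open>\<phi> v\<close>.\<close>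

definition visible :: "nat \<Rightarrow> 'g set" where
  "visible v = {g \<in> W. s g v \<in> J}"

text \<open>A relation rather than a function: the estimates below hold for arbitrary repairs at
  different vertices, so no compatible choice has to be made.\<close>

definition repaired :: "nat \<Rightarrow> 'x \<Rightarrow> bool" where
  "repaired v z \<longleftrightarrow> z \<in> X \<and>
     (\<forall>h\<in>carrier G. (\<forall>g\<in>visible v. h \<otimes> inv g \<notin> A) \<longrightarrow> dist (\<alpha> h z) (\<alpha> h (\<phi> v)) \<le> 2 * \<epsilon>) \<and>
     (\<forall>g\<in>visible v. \<forall>b\<in>B. dist (\<alpha> b (f (s g v))) (\<alpha> (b \<otimes> g) z) \<le> \<epsilon> + \<epsilon>')"

lemma s_closed: "g \<in> P \<Longrightarrow> v \<in> {1..N} \<Longrightarrow> s g v \<in> {1..N}"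
  using perm[of g] permutes_in_image[of "s g" "{1..N}" v] by blast

lemma goodD:
  assumes "good v"
  shows "v \<in> {1..N}"
    and "\<lbrakk>g \<in> P; h \<in> P\<rbrakk> \<Longrightarrow> s (g \<otimes> h) v = s g (s h v)"
    and "\<lbrakk>g \<in> P; h \<in> P; g \<noteq> h\<rbrakk> \<Longrightarrow> s g v \<noteq> s h v"
    and "g \<in> P \<Longrightarrow> dist (\<phi> (s g v)) (\<alpha> g (\<phi> v)) \<le> \<eta>"
  using assms by (auto simp: model_good_def sofic_good_def)

text \<open>Gluing applies to all visible locations at once, because overlapping influence would
  produce two marked vertices in conflict.\<close>

lemma repaired_exists:
  assumes v: "good v"
  shows "\<exists>z. repaired v z"
proof -
  note gv = goodD[OF v]
  have vis: "g \<in> P" "g \<in> carrier G" "s g v \<in> J" if "g \<in> visible v" for g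
    using that P by (auto simp: visible_def)
  obtain z where "z \<in> X"
    "\<And>h. \<lbrakk>h \<in> carrier G; \<And>g. g \<in> visible v \<Longrightarrow> h \<otimes> inv g \<notin> A\<rbrakk> \<Longrightarrow>
      dist (\<alpha> h z) (\<alpha> h (\<phi> v)) \<le> 2 * \<epsilon>"
    "\<And>g b. \<lbrakk>g \<in> visible v; b \<in> B\<rbrakk> \<Longrightarrow> dist (\<alpha> b (f (s g v))) (\<alpha> (b \<otimes> g) z) \<le> \<epsilon> + \<epsilon>'"
  proof (rule gluing_finite_set[of \<epsilon> \<epsilon>' E A influence \<delta> B "visible v" "\<phi> v" "\<lambda>g. f (s g v)"])
    fix g g' h
    assume gg: "g \<in> visible v" "g' \<in> visible v" "g \<noteq> g'" and h: "h \<in> carrier G"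
      and hg: "h \<otimes> inv g \<in> influence"
    show "h \<otimes> inv g' \<notin> influence"
    proof
      assume hg': "h \<otimes> inv g' \<in> influence"
      define t where "t = g' \<otimes> inv g"
      have gc: "g \<in> carrier G" "g' \<in> carrier G" using gg vis by auto
      have "t = inv (h \<otimes> inv g') \<otimes> (h \<otimes> inv g)"
        unfolding t_def using h gc by (simp add: inv_mult_group m_assoc inv_solve_left)
      moreover have "t \<noteq> \<one>"
        using gc gg(3) unfolding t_def by (metis inv_equality inv_inv inv_closed)
      ultimately have t: "t \<in> conflicts" using hg hg' by (auto simp: conflicts_def)
      have "g' = t \<otimes> g" using gc by (simp add: t_def m_assoc)
      \<comment> \<open>Multiplicativity at \<open>v\<close> carries the conflict \<open>t\<close>
        from the group to the vertices; freeness at \<open>v\<close> keeps the two marked vertices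
        distinct, against the independence of \<open>J\<close>.\<close>
      then have "s t (s g v) = s g' v" using gv(2)[of t g] t P(4) vis(1)[OF gg(1)] by auto
      moreover have "s g v \<noteq> s g' v" using gv(3) gg vis by blast
      ultimately show False using J_indep t vis(3) gg by blast
    qed
  next
    fix g b assume g: "g \<in> visible v" and b: "b \<in> B - A"
    have bc: "b \<in> carrier G" using b AB by auto
    have X: "\<phi> (s g v) \<in> X" "\<phi> v \<in> X" "\<alpha> g (\<phi> v) \<in> X"
      using \<phi> s_closed gv(1) vis[OF g] by auto
    have 1: "dist (\<alpha> b (f (s g v))) (\<alpha> b x) \<le> \<delta> / 2"
      using f_near vis(3)[OF g] b by simp
    have 2: "dist (\<alpha> b (\<phi> (s g v))) (\<alpha> b x) \<le> \<delta> / 8"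
      using J_near vis(3)[OF g] b by simp
    have "dist (\<alpha> b (\<phi> (s g v))) (\<alpha> b (\<alpha> g (\<phi> v))) \<le> min \<epsilon> (\<delta> / 8)"
      using equicontinuous[OF X(1,3) gv(4)[OF vis(1)[OF g]]] b by simp
    then have 3: "dist (\<alpha> b (\<phi> (s g v))) (\<alpha> (b \<otimes> g) (\<phi> v)) \<le> \<delta> / 8"
      using X bc vis(2)[OF g] by (simp add: act_mult)
    have "dist (\<alpha> b (f (s g v))) (\<alpha> (b \<otimes> g) (\<phi> v)) \<le>
        dist (\<alpha> b (f (s g v))) (\<alpha> b x) + dist (\<alpha> b x) (\<alpha> (b \<otimes> g) (\<phi> v))"
      by (rule dist_triangle)
    also have "dist (\<alpha> b x) (\<alpha> (b \<otimes> g) (\<phi> v)) \<le>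
        dist (\<alpha> b (\<phi> (s g v))) (\<alpha> b x) + dist (\<alpha> b (\<phi> (s g v))) (\<alpha> (b \<otimes> g) (\<phi> v))"
      by (rule dist_triangle3)
    \<comment> \<open>The budget is exact: \<open>\<delta> / 2\<close> from the target to
      \<open>x\<close>, twice \<open>\<delta> / 8\<close> from \<open>x\<close> through the model to
      the orbit of \<open>\<phi> v\<close>, and
      \<open>\<epsilon>' \<le> \<delta> / 4\<close>.\<close>
    finally show "dist (\<alpha> b (f (s g v))) (\<alpha> (b \<otimes> g) (\<phi> v)) + \<epsilon>' \<le> \<delta>"
      using 1 2 3 eps by linarith
  next
    show "finite (visible v)" using W(1) by (simp add: visible_def)
    show "visible v \<subseteq> carrier G" using vis by blast
    show "\<phi> v \<in> X" using \<phi> gv(1) by blast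
    show "memory_set G X \<alpha> \<epsilon> \<delta> A B" by (rule memory)
  qed (use eps window E f vis in \<open>auto simp: influence_def\<close>)
  then show ?thesis unfolding repaired_def by blast
qed

text \<open>A marked vertex sees itself at the location \<open>\<one>\<close>, and
  \<open>\<one>\<close> lies in \<open>A\<close> and hence in \<open>B\<close>.\<close>

lemma repaired_near:
  assumes "a \<in> J" "repaired a z"
  shows "dist (f a) z \<le> \<epsilon> + \<epsilon>'"
proof -
  have oneP: "\<one> \<in> P" using W P by auto
  have a: "s \<one> a = a"
    using sofic_good_one[of P s a] oneP permutes_inj[OF perm[OF oneP]] J_good[OF assms(1)]
    by (simp add: model_good_def)
  then have "\<one> \<in> visible a" using W assms(1) by (simp add: visible_def)
  then have "dist (\<alpha> \<one> (f (s \<one> a))) (\<alpha> (\<one> \<otimes> \<one>) z) \<le> \<epsilon> + \<epsilon>'"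
    using assms(2) one_A AB unfolding repaired_def by blast
  then show ?thesis using a assms f by (simp add: repaired_def)
qed

text \<open>Near a mark, both repairs follow the same target, since the mark at \<open>g'\<close>
  seen from \<open>s g v\<close> is the mark at \<open>g' \<otimes> g\<close> seen from
  \<open>v\<close>. Away from all marks, both follow the model, which is almost equivariant. The
  bound \<open>c\<close> is all that the finite window test for closeness requires.\<close>

lemma repaired_equivariant:
  assumes v: "good v" and g: "g \<in> F" and gv: "good (s g v)"
    and z: "repaired v z" and w: "repaired (s g v) w" and h: "h \<in> H"
  shows "dist (\<alpha> h w) (\<alpha> h (\<alpha> g z)) \<le> c"
proof -
  have zX: "z \<in> X" and wX: "w \<in> X" using z w by (auto simp: repaired_def)
  have gP: "g \<in> P" and gc: "g \<in> carrier G" and hc: "h \<in> carrier G" using g h P H by auto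
  have common: ?thesis if g': "g' \<in> visible (s g v)" and a: "h \<otimes> inv g' \<in> A" for g'
  proof -
    define a where "a = h \<otimes> inv g'"
    have g'P: "g' \<in> P" "g' \<in> carrier G" using g' P by (auto simp: visible_def)
    have aA: "a \<in> A" "a \<in> carrier G" using that AB by (auto simp: a_def)
    have "g' = inv a \<otimes> h" using g'P hc by (simp add: a_def inv_mult_group m_assoc)
    \<comment> \<open>The window \<open>W\<close> is large enough that a mark influencing
      \<open>h\<close> from \<open>s g v\<close> is also visible from \<open>v\<close>.\<close>
    then have "g' \<otimes> g \<in> W" using W(4) aA h g by auto
    moreover have eq: "s (g' \<otimes> g) v = s g' (s g v)" using goodD(2)[OF v] g'P gP by blast
    ultimately have vis: "g' \<otimes> g \<in> visible v" using g' by (simp add: visible_def)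
    have ag: "a \<otimes> g' = h" using g'P hc by (simp add: a_def m_assoc)
    then have ag': "a \<otimes> (g' \<otimes> g) = h \<otimes> g" using aA g'P gc by (simp add: m_assoc[symmetric])
    let ?p = "\<alpha> a (f (s g' (s g v)))"
    have "a \<in> B" using aA AB by blast
    then have "dist ?p (\<alpha> h w) \<le> \<epsilon> + \<epsilon>'" "dist ?p (\<alpha> (h \<otimes> g) z) \<le> \<epsilon> + \<epsilon>'"
      using w z g' vis ag ag' eq unfolding repaired_def by metis+
    \<comment> \<open>Both points are within \<open>\<epsilon> + \<epsilon>'\<close> of the common
      target, and
      \<open>2 * (\<epsilon> + \<epsilon>') \<le> 3 * \<epsilon> \<le> c\<close>.\<close>
    then have "dist (\<alpha> h w) (\<alpha> (h \<otimes> g) z) \<le> c"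
      using dist_triangle3[of "\<alpha> h w" "\<alpha> (h \<otimes> g) z" ?p] eps by linarith
    then show ?thesis using zX hc gc by (simp add: act_mult)
  qed
  show ?thesis
  proof (cases "\<exists>g'\<in>visible (s g v). h \<otimes> inv g' \<in> A")
    case True
    then show ?thesis using common by blast
  next
    case no_w: False
    show ?thesis
    proof (cases "\<exists>k\<in>visible v. h \<otimes> g \<otimes> inv k \<in> A")
      case True
      then obtain k where k: "k \<in> visible v" "h \<otimes> g \<otimes> inv k \<in> A" by blast
      define a where "a = h \<otimes> g \<otimes> inv k"
      \<comment> \<open>The mark at \<open>k\<close> seen from \<open>v\<close>, in the coordinates
        of \<open>s g v\<close>; this reduces the case to \<open>common\<close>.\<close>
      define g' where "g' = k \<otimes> inv g"
      have kP: "k \<in> carrier G" using k P by (auto simp: visible_def)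
      have g'c: "g' \<in> carrier G" using kP gc by (simp add: g'_def)
      have a: "h \<otimes> inv g' = a"
        using kP gc hc by (simp add: a_def g'_def inv_mult_group m_assoc)
      then have "inv a \<otimes> h = g'"
        using g'c hc by (metis inv_closed inv_mult_group inv_inv inv_solve_right m_closed)
      then have g'W: "g' \<in> W" using W(3)[of a h] k h by (auto simp: a_def)
      then have "s (g' \<otimes> g) v = s g' (s g v)" using goodD(2)[OF v] gP P by blast
      moreover have "g' \<otimes> g = k" using kP gc by (simp add: g'_def m_assoc)
      ultimately have "g' \<in> visible (s g v)" using k g'W by (simp add: visible_def)
      then show ?thesis using common a k(2) by (simp add: a_def)
    next
      case no_v: False
      have X: "\<phi> v \<in> X" "\<phi> (s g v) \<in> X" "\<alpha> g (\<phi> v) \<in> X"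
        using \<phi> goodD(1)[OF v] goodD(1)[OF gv] gc by auto
      have 1: "dist (\<alpha> h w) (\<alpha> h (\<phi> (s g v))) \<le> 2 * \<epsilon>"
        using w no_w hc by (auto simp: repaired_def)
      have 2: "dist (\<alpha> (h \<otimes> g) z) (\<alpha> (h \<otimes> g) (\<phi> v)) \<le> 2 * \<epsilon>"
        using z no_v hc gc by (auto simp: repaired_def)
      have "dist (\<alpha> h (\<phi> (s g v))) (\<alpha> h (\<alpha> g (\<phi> v))) \<le> min \<epsilon> (\<delta> / 8)"
        using equicontinuous[OF X(2,3) goodD(4)[OF v gP]] h by simp
      then have 3: "dist (\<alpha> h (\<phi> (s g v))) (\<alpha> (h \<otimes> g) (\<phi> v)) \<le> \<epsilon>"
        using X hc gc by (simp add: act_mult)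
      \<comment> \<open>Two repairs at cost \<open>2 * \<epsilon>\<close> each and the defect
        \<open>\<epsilon>\<close> of the model: this is where \<open>5 * \<epsilon> \<le> c\<close>
        comes from.\<close>
      have "dist (\<alpha> h w) (\<alpha> (h \<otimes> g) z) \<le> c"
        using 1 2 3 eps(1) dist_triangle[of "\<alpha> h w" "\<alpha> (h \<otimes> g) z" "\<alpha> h (\<phi> (s g v))"]
          dist_triangle2[of "\<alpha> h (\<phi> (s g v))" "\<alpha> (h \<otimes> g) z" "\<alpha> (h \<otimes> g) (\<phi> v)"]
        by linarith
      then show ?thesis using zX hc gc by (simp add: act_mult)
    qed
  qed
qed

text \<open>If \<open>v\<close> and \<open>s g v\<close> are both good, the test on \<open>H\<close>
  gives a defect below \<open>\<rho> / 2\<close>. The few remaining vertices are paid for with the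
  diameter bound \<open>D\<close>.\<close>

lemma repaired_Map:
  assumes H_window: "\<And>u w. \<lbrakk>u \<in> X; w \<in> X; \<And>h. h \<in> H \<Longrightarrow> dist (\<alpha> h u) (\<alpha> h w) \<le> c\<rbrakk> \<Longrightarrow> dist u w < \<rho> / 2"
    and D: "\<And>u w. \<lbrakk>u \<in> X; w \<in> X\<rbrakk> \<Longrightarrow> dist u w \<le> D"
    and bad: "real (card {v\<in>{1..N}. \<not> good v}) \<le> \<beta> * real N"
    and \<beta>: "4 * \<beta> * D\<^sup>2 \<le> \<rho>\<^sup>2" and "N > 0" "\<rho> > 0"
  shows "\<exists>\<psi>\<in>sofic_Map X \<alpha> F \<rho> N s. \<forall>a\<in>J. dist (f a) (\<psi> a) \<le> \<epsilon> + \<epsilon>'"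
proof
  \<comment> \<open>At bad vertices any point of \<open>X\<close> would do; the old value is
    kept.\<close>
  define \<psi> where "\<psi> = (\<lambda>v\<in>{1..N}. if good v then SOME z. repaired v z else \<phi> v)"
  have rep: "repaired v (\<psi> v)" if "good v" for v
    using someI_ex[OF repaired_exists[OF that]] goodD(1)[OF that] that by (simp add: \<psi>_def)
  have \<psi>X: "\<psi> v \<in> X" if "v \<in> {1..N}" for v
  proof (cases "good v")
    case True
    then show ?thesis using rep repaired_def by blast
  next
    case False
    then show ?thesis using \<phi> that by (simp add: \<psi>_def)
  qed
  show "\<forall>a\<in>J. dist (f a) (\<psi> a) \<le> \<epsilon> + \<epsilon>'"
    using repaired_near rep J_good by blast
  \<comment> \<open>A penalty for bad vertices: the squared defect at \<open>v\<close> is charged to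
    \<open>v\<close> and to \<open>s g v\<close>.\<close>
  define p where "p v = (if good v then 0 else D\<^sup>2)" for v
  have sum_p: "(\<Sum>v=1..N. p v) \<le> \<beta> * real N * D\<^sup>2"
  proof -
    have "(\<Sum>v=1..N. p v) = real (card {v\<in>{1..N}. \<not> good v}) * D\<^sup>2"
      unfolding p_def by (subst sum.If_cases) (auto simp: Int_def)
    then show ?thesis using mult_right_mono[OF bad, of "D\<^sup>2"] by simp
  qed
  have "sqrt (1 / real N * (\<Sum>v=1..N. (dist (\<psi> (s g v)) (\<alpha> g (\<psi> v)))\<^sup>2)) \<le> \<rho>" if g: "g \<in> F" for g
  proof -
    have gP: "g \<in> P" and gc: "g \<in> carrier G" using g P by auto
    have pt: "(dist (\<psi> (s g v)) (\<alpha> g (\<psi> v)))\<^sup>2 \<le> (\<rho> / 2)\<^sup>2 + (p v + p (s g v))"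
      if v: "v \<in> {1..N}" for v
    proof (cases "good v \<and> good (s g v)")
      case True
      have "dist (\<psi> (s g v)) (\<alpha> g (\<psi> v)) < \<rho> / 2"
        using True repaired_equivariant[OF _ g _ rep rep] \<psi>X v s_closed[OF gP v] gc
        by (intro H_window) auto
      then have "(dist (\<psi> (s g v)) (\<alpha> g (\<psi> v)))\<^sup>2 \<le> (\<rho> / 2)\<^sup>2" by (intro power_mono) auto
      then show ?thesis using True by (simp add: p_def)
    next
      case False
      have "dist (\<psi> (s g v)) (\<alpha> g (\<psi> v)) \<le> D"
        using D \<psi>X v s_closed[OF gP v] gc by simp
      then have "(dist (\<psi> (s g v)) (\<alpha> g (\<psi> v)))\<^sup>2 \<le> D\<^sup>2" by (intro power_mono) auto
      also have "\<dots> \<le> p v + p (s g v)" using False by (auto simp: p_def)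
      finally show ?thesis by (simp add: add_increasing)
    qed
    have "(\<Sum>v=1..N. (dist (\<psi> (s g v)) (\<alpha> g (\<psi> v)))\<^sup>2) \<le>
        (\<Sum>v=1..N. (\<rho> / 2)\<^sup>2 + (p v + p (s g v)))"
      by (intro sum_mono pt)
    also have "\<dots> = real N * (\<rho> / 2)\<^sup>2 + ((\<Sum>v=1..N. p v) + (\<Sum>v=1..N. p (s g v)))"
      by (simp add: sum.distrib)
    \<comment> \<open>Since \<open>s g\<close> is a permutation, the penalties at the image vertices
      have the same total.\<close>
    also have "(\<Sum>v=1..N. p (s g v)) = (\<Sum>v=1..N. p v)"
      using sum.permute[OF perm[OF gP], of p] by simp
    also have "real N * (\<rho> / 2)\<^sup>2 + ((\<Sum>v=1..N. p v) + (\<Sum>v=1..N. p v)) \<le>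
        real N * (\<rho> / 2)\<^sup>2 + 2 * (\<beta> * real N * D\<^sup>2)"
      using sum_p by simp
    also have "\<dots> \<le> \<rho>\<^sup>2 * real N"
    proof -
      have "(\<rho> / 2)\<^sup>2 + 2 * (\<beta> * D\<^sup>2) \<le> \<rho>\<^sup>2"
      proof -
        have "(\<rho> / 2)\<^sup>2 = \<rho>\<^sup>2 / 4" by (simp add: power_divide)
        moreover have "4 * (\<beta> * D\<^sup>2) \<le> \<rho>\<^sup>2" using \<beta> by (simp add: mult.assoc)
        ultimately show ?thesis using zero_le_power2[of \<rho>] by linarith
      qed
      from mult_right_mono[OF this, of "real N"] show ?thesis by (simp add: algebra_simps)
    qed
    finally have "1 / real N * (\<Sum>v=1..N. (dist (\<psi> (s g v)) (\<alpha> g (\<psi> v)))\<^sup>2) \<le> \<rho>\<^sup>2"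
      using \<open>N > 0\<close> by (simp add: field_simps)
    then show ?thesis using \<open>\<rho> > 0\<close> by (intro real_le_lsqrt) auto
  qed
  then show "\<psi> \<in> sofic_Map X \<alpha> F \<rho> N s"
    using \<psi>X by (auto simp: sofic_Map_def \<psi>_def)
qed

end

section \<open>Asymptotic partners and entropy\<close>

lemma (in compact_action) asymptotic_pairs_window:
  assumes "(x, y) \<in> asymptotic_pairs G X \<alpha>" "\<epsilon> > 0"
  shows "\<exists>A. finite A \<and> A \<subseteq> carrier G \<and> \<one> \<in> A \<and>
    (\<forall>g\<in>carrier G - A. dist (\<alpha> g x) (\<alpha> g y) \<le> \<epsilon>)"
proof -
  obtain A where "finite A" "A \<subseteq> carrier G" "\<forall>g\<in>carrier G - A. dist (\<alpha> g x) (\<alpha> g y) \<le> \<epsilon>"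
    using assms unfolding asymptotic_pairs_def by blast
  then show ?thesis by (intro exI[of _ "insert \<one> A"]) auto
qed

text \<open>Density gives one asymptotic pair \<open>(x, y)\<close> with \<open>x\<close> in
  \<open>U\<close> and \<open>y\<close> in \<open>V\<close>. For \<open>w\<close> near
  \<open>x\<close>, the Markov property produces a point that follows \<open>y\<close> on
  \<open>B\<close> and \<open>w\<close> off \<open>A\<close>: it lies in \<open>V\<close> and is
  asymptotic to \<open>w\<close>.\<close>

lemma (in expansive_action) asymptotic_partners_open:
  assumes tmp: "topological_Markov_property G X \<alpha>"
    and dense: "closure (asymptotic_pairs G X \<alpha>) = X \<times> X"
    and U: "openin (top_of_set X) U" "U \<noteq> {}" and V: "openin (top_of_set X) V" "V \<noteq> {}"
  obtains U' where "openin (top_of_set X) U'" "U' \<noteq> {}" "U' \<subseteq> U"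
    "\<And>w. w \<in> U' \<Longrightarrow> \<exists>z\<in>V. (w, z) \<in> asymptotic_pairs G X \<alpha>"
proof -
  obtain U0 V0 where UV0: "open U0" "U = X \<inter> U0" "open V0" "V = X \<inter> V0"
    using U V by (auto simp: openin_open)
  obtain u v where "u \<in> U" "v \<in> V" using U V by auto
  then have "(u, v) \<in> (U0 \<times> V0) \<inter> closure (asymptotic_pairs G X \<alpha>)"
    unfolding dense using UV0 by auto
  then have "(U0 \<times> V0) \<inter> asymptotic_pairs G X \<alpha> \<noteq> {}"
    using open_Int_closure_eq_empty[OF open_Times[OF UV0(1,3)]] by fastforce
  then obtain x y where xy: "(x, y) \<in> asymptotic_pairs G X \<alpha>" "x \<in> U0" "y \<in> V0" by auto
  then have X: "x \<in> X" "y \<in> X" by (auto simp: asymptotic_pairs_def)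
  obtain e where e: "e > 0" "cball y e \<subseteq> V0"
    using UV0(3) xy(3) open_contains_cball by blast
  \<comment> \<open>The bound \<open>e\<close> keeps the new point in \<open>V\<close>; the bound
    \<open>c\<close> lets expansiveness turn closeness off \<open>A\<close> into
    asymptoticity.\<close>
  define \<epsilon> where "\<epsilon> = min e c"
  have \<epsilon>: "\<epsilon> > 0" "\<epsilon> \<le> c" "cball y \<epsilon> \<subseteq> V0" using e c_pos by (auto simp: \<epsilon>_def)
  have "\<exists>\<delta>>0. \<forall>A. finite A \<and> A \<subseteq> carrier G \<longrightarrow> (\<exists>B. memory_set G X \<alpha> \<epsilon> \<delta> A B)"
    using tmp \<epsilon>(1) by (simp add: topological_Markov_property_def)
  then obtain \<delta> where \<delta>: "\<delta> > 0"
    "\<forall>A. finite A \<and> A \<subseteq> carrier G \<longrightarrow> (\<exists>B. memory_set G X \<alpha> \<epsilon> \<delta> A B)"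
    by (elim exE conjE)
  have "\<exists>A. finite A \<and> A \<subseteq> carrier G \<and> \<one> \<in> A \<and>
      (\<forall>g\<in>carrier G - A. dist (\<alpha> g x) (\<alpha> g y) \<le> \<delta> / 2)"
    using xy(1) \<delta>(1) by (intro asymptotic_pairs_window) auto
  then obtain A where A: "finite A" "A \<subseteq> carrier G" "\<one> \<in> A"
    "\<forall>g\<in>carrier G - A. dist (\<alpha> g x) (\<alpha> g y) \<le> \<delta> / 2"
    by (elim exE conjE)
  obtain B where memory: "memory_set G X \<alpha> \<epsilon> \<delta> A B" using \<delta>(2) A(1,2) by blast
  then have B: "finite B" "A \<subseteq> B" "B \<subseteq> carrier G" by (auto simp: memory_set_def)
  obtain r where r: "r > 0"
    "\<And>u w b. \<lbrakk>u \<in> X; w \<in> X; dist u w \<le> r; b \<in> B\<rbrakk> \<Longrightarrow> dist (\<alpha> b u) (\<alpha> b w) \<le> \<delta> / 2"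
    using act_equicontinuous[OF B(1,3), of "\<delta> / 2"] \<delta>(1) by auto
  show thesis
  proof (rule that[of "U \<inter> ball x r"])
    show "openin (top_of_set X) (U \<inter> ball x r)" using U(1) by (simp add: openin_Int_open)
    show "U \<inter> ball x r \<noteq> {}" using xy(2) X UV0 r by auto
    fix w assume w: "w \<in> U \<inter> ball x r"
    then have wX: "w \<in> X" using UV0 by blast
    have "dist_on \<alpha> (B - A) y w \<le> ennreal \<delta>"
      unfolding dist_on_def
    proof (rule SUP_least, rule ennreal_leI)
      fix b assume b: "b \<in> B - A"
      have "dist (\<alpha> b x) (\<alpha> b y) \<le> \<delta> / 2" using A(4) b B by blast
      moreover have "dist (\<alpha> b x) (\<alpha> b w) \<le> \<delta> / 2" using r(2)[of x w b] w b wX X by auto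
      ultimately show "dist (\<alpha> b y) (\<alpha> b w) \<le> \<delta>"
        using dist_triangle3[of "\<alpha> b y" "\<alpha> b w" "\<alpha> b x"] by linarith
    qed
    then obtain z where z: "z \<in> X" "dist_on \<alpha> B y z \<le> ennreal \<epsilon>"
      "dist_on \<alpha> (carrier G - A) w z \<le> ennreal \<epsilon>"
      using memory X wX unfolding memory_set_def by blast
    have "ennreal (dist (\<alpha> \<one> y) (\<alpha> \<one> z)) \<le> ennreal \<epsilon>"
      using z(2) A(3) B(2) unfolding dist_on_def by (auto simp: SUP_le_iff)
    then have "z \<in> V" using z(1) X \<epsilon> UV0 by auto
    have far: "dist (\<alpha> g w) (\<alpha> g z) \<le> c" if "g \<in> carrier G - A" for g
    proof -
      have "ennreal (dist (\<alpha> g w) (\<alpha> g z)) \<le> ennreal \<epsilon>"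
        using z(3) that unfolding dist_on_def by (auto simp: SUP_le_iff)
      then show ?thesis using \<epsilon> by auto
    qed
    have "\<exists>F. finite F \<and> F \<subseteq> carrier G \<and> (\<forall>g\<in>carrier G - F. dist (\<alpha> g w) (\<alpha> g z) \<le> \<epsilon>')"
      if "\<epsilon>' > 0" for \<epsilon>' :: real
    proof -
      obtain E where E: "finite E" "E \<subseteq> carrier G"
        "\<forall>u\<in>X. \<forall>w\<in>X. (\<forall>g\<in>E. dist (\<alpha> g u) (\<alpha> g w) \<le> c) \<longrightarrow> dist u w < \<epsilon>'"
        using expansive_finite_window[OF \<open>\<epsilon>' > 0\<close>] by (elim exE conjE)
      \<comment> \<open>Outside this finite set the window \<open>E g\<close> avoids
        \<open>A\<close>, so distances at most \<open>c\<close> there force distance below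
        \<open>\<epsilon>'\<close> at \<open>g\<close>.\<close>
      let ?F = "{h \<in> carrier G. \<exists>e\<in>E. e \<otimes> h \<in> A}"
      have "dist (\<alpha> g w) (\<alpha> g z) \<le> \<epsilon>'" if g: "g \<in> carrier G - ?F" for g
      proof (rule less_imp_le, rule E(3)[rule_format])
        fix e assume "e \<in> E"
        then have "e \<in> carrier G" "e \<otimes> g \<in> carrier G - A" using g E by auto
        then show "dist (\<alpha> e (\<alpha> g w)) (\<alpha> e (\<alpha> g z)) \<le> c"
          using far g wX z(1) by (simp add: act_mult)
      qed (use g wX z in auto)
      then show ?thesis using finite_quotient_set[OF E(1,2) A(1)] by (intro exI[of _ ?F]) auto
    qed
    then have "(w, z) \<in> asymptotic_pairs G X \<alpha>" using wX z by (auto simp: asymptotic_pairs_def)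
    then show "\<exists>z\<in>V. (w, z) \<in> asymptotic_pairs G X \<alpha>" using \<open>z \<in> V\<close> by blast
  qed auto
qed

text \<open>The target sets are handled one at a time, each shrinking the nonempty open set of
  admissible \<open>x\<close>, starting from \<open>X\<close> itself.\<close>

lemma (in expansive_action) common_asymptotic_partner:
  assumes tmp: "topological_Markov_property G X \<alpha>"
    and dense: "closure (asymptotic_pairs G X \<alpha>) = X \<times> X" and "X \<noteq> {}"
    and "\<And>V. V \<in> set Vs \<Longrightarrow> openin (top_of_set X) V \<and> V \<noteq> {}"
  shows "\<exists>x\<in>X. \<forall>V\<in>set Vs. \<exists>y\<in>V. (x, y) \<in> asymptotic_pairs G X \<alpha>"
proof -
  have "\<exists>U. openin (top_of_set X) U \<and> U \<noteq> {} \<and>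
      (\<forall>x\<in>U. \<forall>V\<in>set Vs. \<exists>y\<in>V. (x, y) \<in> asymptotic_pairs G X \<alpha>)"
    using assms(4)
  proof (induction Vs)
    case Nil
    then show ?case using \<open>X \<noteq> {}\<close> by (intro exI[of _ X]) simp
  next
    case (Cons V Vs)
    then obtain U where U: "openin (top_of_set X) U" "U \<noteq> {}"
      "\<forall>x\<in>U. \<forall>V\<in>set Vs. \<exists>y\<in>V. (x, y) \<in> asymptotic_pairs G X \<alpha>" by auto
    obtain U' where "openin (top_of_set X) U'" "U' \<noteq> {}" "U' \<subseteq> U"
      "\<And>w. w \<in> U' \<Longrightarrow> \<exists>z\<in>V. (w, z) \<in> asymptotic_pairs G X \<alpha>"
      using asymptotic_partners_open[OF tmp dense U(1,2)] Cons.prems[of V] by auto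
    then show ?case using U(3) by (intro exI[of _ U']) auto
  qed
  then obtain U where U: "openin (top_of_set X) U" "U \<noteq> {}"
    "\<forall>x\<in>U. \<forall>V\<in>set Vs. \<exists>y\<in>V. (x, y) \<in> asymptotic_pairs G X \<alpha>"
    by (elim exE conjE)
  then obtain x where x: "x \<in> U" by blast
  show ?thesis using x U(3) openin_imp_subset[OF U(1)] by blast
qed

section \<open>Entropy from independence\<close>

lemma ln_enat_ge:
  assumes "enat k \<le> m" "k > 0"
  shows "ereal (ln (real k)) \<le> ln_enat m"
proof (cases m)
  case (enat j)
  then have "0 < j" "k \<le> j" using assms by auto
  then show ?thesis using enat assms(2) by (simp add: ln_enat_def)
qed (simp add: ln_enat_def)

text \<open>Different choice functions differ at some vertex of \<open>J\<close>, where their models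
  lie in the two \<open>r\<close>-separated sets.\<close>

lemma separation_number_independence:
  assumes J: "independence_set X \<alpha> F \<delta> N s [U, V] J"
    and sep: "\<And>u v. \<lbrakk>u \<in> U; v \<in> V\<rbrakk> \<Longrightarrow> r \<le> dist u v" and "r > 0"
  shows "enat (2 ^ card J) \<le> separation_number r N (sofic_Map X \<alpha> F \<delta> N s)"
proof -
  have JN: "J \<subseteq> {1..N}" "finite J"
    using J finite_subset by (auto simp: independence_set_def)
  let ?\<Omega> = "J \<rightarrow>\<^sub>E {..<2::nat}"
  have "\<forall>\<omega>\<in>?\<Omega>. \<exists>\<phi>\<in>sofic_Map X \<alpha> F \<delta> N s. \<forall>a\<in>J. \<phi> a \<in> [U, V] ! \<omega> a"
    using J by (simp add: independence_set_def numeral_2_eq_2)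
  then obtain \<Phi> where \<Phi>: "\<And>\<omega>. \<omega> \<in> ?\<Omega> \<Longrightarrow> \<Phi> \<omega> \<in> sofic_Map X \<alpha> F \<delta> N s"
    "\<And>\<omega> a. \<omega> \<in> ?\<Omega> \<Longrightarrow> a \<in> J \<Longrightarrow> \<Phi> \<omega> a \<in> [U, V] ! \<omega> a" by metis
  have far: "r \<le> max_dist N (\<Phi> \<omega>) (\<Phi> \<omega>') \<and> \<Phi> \<omega> \<noteq> \<Phi> \<omega>'"
    if \<omega>: "\<omega> \<in> ?\<Omega>" "\<omega>' \<in> ?\<Omega>" "\<omega> \<noteq> \<omega>'" for \<omega> \<omega>'
  proof -
    obtain a where a: "a \<in> J" "\<omega> a \<noteq> \<omega>' a"
      using \<omega> by (metis PiE_ext)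
    have "\<omega> a < 2" "\<omega>' a < 2" using \<omega> a by auto
    then have "(\<omega> a = 0 \<and> \<omega>' a = 1) \<or> (\<omega> a = 1 \<and> \<omega>' a = 0)" using a(2) by linarith
    then have r: "r \<le> dist (\<Phi> \<omega> a) (\<Phi> \<omega>' a)"
      using \<Phi>(2)[OF \<omega>(1) a(1)] \<Phi>(2)[OF \<omega>(2) a(1)] sep[of "\<Phi> \<omega> a" "\<Phi> \<omega>' a"] sep[of "\<Phi> \<omega>' a" "\<Phi> \<omega> a"]
      by (auto simp: dist_commute)
    also have "\<dots> \<le> max_dist N (\<Phi> \<omega>) (\<Phi> \<omega>')"
      unfolding max_dist_def using a(1) JN by (intro Max_ge) auto
    finally show ?thesis using r \<open>r > 0\<close> by auto
  qed
  have fin: "finite ?\<Omega>" using JN by (intro finite_PiE) auto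
  have "inj_on \<Phi> ?\<Omega>" using far by (meson inj_onI)
  then have "card (\<Phi> ` ?\<Omega>) = 2 ^ card J"
    using JN by (simp add: card_image card_PiE)
  moreover have "\<Phi> ` ?\<Omega> \<in> {S. S \<subseteq> sofic_Map X \<alpha> F \<delta> N s \<and> finite S \<and>
      (\<forall>\<phi>\<in>S. \<forall>\<psi>\<in>S. \<phi> \<noteq> \<psi> \<longrightarrow> r \<le> max_dist N \<phi> \<psi>)}"
    using \<Phi>(1) fin far by blast
  ultimately show ?thesis unfolding separation_number_def by (metis (no_types, lifting) SUP_upper)
qed

text \<open>Independence sets of proportion \<open>q\<close> give the lower bound
  \<open>q * ln 2\<close> at a fixed scale \<open>r\<close>, uniformly in \<open>F\<close> and
  \<open>\<delta>\<close>.\<close>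

lemma sofic_top_entropy_pos:
  assumes n: "\<And>i. n i > 0" and IE: "[x, y] \<in> IE G n \<sigma> X \<alpha> 2" and "x \<noteq> y"
  shows "sofic_top_entropy G n \<sigma> X \<alpha> > 0"
proof -
  \<comment> \<open>A third of the distance makes the \<open>r\<close>-balls around \<open>x\<close>
    and \<open>y\<close> at least \<open>r\<close> apart.\<close>
  define r where "r = dist x y / 3"
  have r: "r > 0" using \<open>x \<noteq> y\<close> by (simp add: r_def)
  let ?U = "X \<inter> ball x r" and ?V = "X \<inter> ball y r"
  have sep: "r \<le> dist u v" if "u \<in> ?U" "v \<in> ?V" for u v
    using that dist_triangle[of x y u] dist_triangle[of u y v]
    by (auto simp: r_def dist_commute)
  have xX: "x \<in> X" "y \<in> X" using IE by (auto simp: IE_def tuples_def)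
  have nb: "neighbourhood_in X z (X \<inter> ball z r)" if "z \<in> X" for z
    unfolding neighbourhood_in_def using that r
    by (intro conjI exI[of _ "X \<inter> ball z r"]) (auto intro: openin_open_Int)
  have "\<forall>j<2. neighbourhood_in X ([x, y] ! j) ([?U, ?V] ! j)"
    using nb xX by (auto simp: less_2_cases_iff)
  then have "positive_upper_independence_density G n \<sigma> X \<alpha> [?U, ?V]"
    using IE unfolding IE_def by simp
  then obtain q where q: "q > 0" "\<And>F \<delta>. \<lbrakk>finite F; F \<subseteq> carrier G; \<delta> > 0\<rbrakk> \<Longrightarrow>
      infinite {i. \<exists>J. independence_set X \<alpha> F \<delta> (n i) (\<sigma> i) [?U, ?V] J \<and> real (card J) \<ge> q * real (n i)}"
    unfolding positive_upper_independence_density_def by blast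
  let ?t = "\<lambda>F \<delta> i. ereal (1 / real (n i)) *
    ln_enat (separation_number r (n i) (sofic_Map X \<alpha> F \<delta> (n i) (\<sigma> i)))"
  have "ereal (q * ln 2) \<le> limsup (?t F \<delta>)" if F: "finite F" "F \<subseteq> carrier G" "\<delta> > 0" for F \<delta>
  proof (rule ccontr)
    assume "\<not> ereal (q * ln 2) \<le> limsup (?t F \<delta>)"
    then have "\<forall>\<^sub>F i in sequentially. ?t F \<delta> i < ereal (q * ln 2)"
      by (intro Limsup_lessD) simp
    then obtain M where M: "\<And>i. i \<ge> M \<Longrightarrow> ?t F \<delta> i < ereal (q * ln 2)"
      unfolding eventually_sequentially by blast
    obtain i J where i: "i \<ge> M" "independence_set X \<alpha> F \<delta> (n i) (\<sigma> i) [?U, ?V] J"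
      "real (card J) \<ge> q * real (n i)"
      using q(2)[OF F] unfolding infinite_nat_iff_unbounded_le by blast
    have "ereal (ln (real (2 ^ card J))) \<le> ln_enat (separation_number r (n i) (sofic_Map X \<alpha> F \<delta> (n i) (\<sigma> i)))"
      by (rule ln_enat_ge[OF separation_number_independence[OF i(2) sep r]]) auto
    then have "ereal (1 / real (n i)) * ereal (real (card J) * ln 2) \<le> ?t F \<delta> i"
      by (intro ereal_mult_left_mono) (auto simp: ln_realpow)
    moreover have "q * ln 2 \<le> 1 / real (n i) * (real (card J) * ln 2)"
      using i(3) n[of i] by (simp add: field_simps)
    then have "ereal (q * ln 2) \<le> ereal (1 / real (n i)) * ereal (real (card J) * ln 2)" by simp
    ultimately show False using M[OF i(1)] by (meson leD order_trans)
  qed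
  then have "ereal (q * ln 2) \<le> sofic_top_entropy G n \<sigma> X \<alpha>"
    unfolding sofic_top_entropy_def using r
    by (intro SUP_upper2[of r] INF_greatest) auto
  moreover have "0 < ereal (q * ln 2)" using q(1) by simp
  ultimately show ?thesis by (meson less_le_trans)
qed

section \<open>Independence density from asymptotic points\<close>

text \<open>The radius is \<open>2 * \<epsilon>\<close> because a repair reaches its target only up
  to \<open>\<epsilon> + \<epsilon>' \<le> 2 * \<epsilon>\<close>.\<close>

lemma neighbourhoods_common_radius:
  fixes Us :: "'x::metric_space set list"
  assumes "\<And>j. j < length Us \<Longrightarrow> neighbourhood_in X (ys ! j) (Us ! j)" and "c > 0"
  shows "\<exists>\<epsilon>>0. \<epsilon> < c \<and> (\<forall>j<length Us. \<forall>z\<in>X. dist (ys ! j) z \<le> 2 * \<epsilon> \<longrightarrow> z \<in> Us ! j)"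
proof -
  have "\<forall>\<^sub>F \<epsilon> in at_right 0. \<forall>z\<in>X. dist (ys ! j) z \<le> 2 * \<epsilon> \<longrightarrow> z \<in> Us ! j"
    if j: "j < length Us" for j
  proof -
    obtain T where T: "openin (top_of_set X) T" "ys ! j \<in> T" "T \<subseteq> Us ! j"
      using assms(1)[OF j] by (auto simp: neighbourhood_in_def)
    then obtain e where e: "e > 0" "cball (ys ! j) e \<inter> X \<subseteq> T"
      unfolding openin_contains_cball by blast
    show ?thesis
      unfolding eventually_at_right_field
    proof (intro exI[of _ "e / 2"] conjI allI impI ballI)
      fix \<epsilon> z assume "\<epsilon> < e / 2" "z \<in> X" "dist (ys ! j) z \<le> 2 * \<epsilon>"
      then have "z \<in> cball (ys ! j) e \<inter> X" by simp
      then show "z \<in> Us ! j" using e(2) T(3) by blast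
    qed (use e in simp)
  qed
  then have "\<forall>\<^sub>F \<epsilon> in at_right 0. \<forall>j\<in>{..<length Us}. \<forall>z\<in>X. dist (ys ! j) z \<le> 2 * \<epsilon> \<longrightarrow> z \<in> Us ! j"
    by (intro eventually_ball_finite) auto
  moreover have "\<forall>\<^sub>F \<epsilon> in at_right 0. \<epsilon> < c" "\<forall>\<^sub>F \<epsilon> in at_right (0::real). 0 < \<epsilon>"
    using \<open>c > 0\<close> unfolding eventually_at_right_field by auto
  ultimately have "\<forall>\<^sub>F \<epsilon> in at_right 0. 0 < \<epsilon> \<and> \<epsilon> < c \<and>
      (\<forall>j<length Us. \<forall>z\<in>X. dist (ys ! j) z \<le> 2 * \<epsilon> \<longrightarrow> z \<in> Us ! j)"
    by eventually_elim auto
  then show ?thesis using eventually_happens trivial_limit_at_right_real by blast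
qed

context marking
begin

text \<open>At most half of \<open>J\<close> is lost to bad vertices, and passing to an independent
  subset costs the factor \<open>card conflicts + 1\<close>. The set \<open>P\<close> and the
  tolerance depend on \<open>F\<close> and \<open>\<rho>\<close>, but the resulting proportion does
  not, as the definition of density demands.\<close>

lemma independence_set_from_model:
  assumes "finite F" "F \<subseteq> carrier G" "\<rho> > 0" "q > 0" "r > 0"
    and r: "\<And>u w b. \<lbrakk>u \<in> X; w \<in> X; dist u w \<le> r; b \<in> B\<rbrakk> \<Longrightarrow> dist (\<alpha> b u) (\<alpha> b w) \<le> \<delta> / 8"
    and sofic: "sofic_approximation G n \<sigma>"
    and ys: "\<And>j. j < length Us \<Longrightarrow> ys ! j \<in> X"
      "\<And>j b. \<lbrakk>j < length Us; b \<in> B - A\<rbrakk> \<Longrightarrow> dist (\<alpha> b (ys ! j)) (\<alpha> b x) \<le> \<delta> / 2"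
      "\<And>j z. \<lbrakk>j < length Us; z \<in> X; dist (ys ! j) z \<le> 2 * \<epsilon>\<rbrakk> \<Longrightarrow> z \<in> Us ! j"
  shows "\<exists>P \<delta>'. finite P \<and> P \<subseteq> carrier G \<and> \<delta>' > 0 \<and>
    (\<forall>\<^sub>F i in sequentially. \<forall>J. independence_set X \<alpha> P \<delta>' (n i) (\<sigma> i) [X \<inter> ball x r] J \<and>
        real (card J) \<ge> q * real (n i) \<longrightarrow>
      (\<exists>J'. independence_set X \<alpha> F \<rho> (n i) (\<sigma> i) Us J' \<and>
        real (card J') \<ge> q / (2 * (real (card conflicts) + 1)) * real (n i)))"
proof -
  obtain H where H: "finite H" "H \<subseteq> carrier G" and H_small:
     "\<forall>u\<in>X. \<forall>w\<in>X. (\<forall>g\<in>H. dist (\<alpha> g u) (\<alpha> g w) \<le> c) \<longrightarrow> dist u w < \<rho> / 2"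
    using expansive_finite_window[OF half_gt_zero[OF \<open>\<rho> > 0\<close>]] by (elim exE conjE)
  define W where "W = insert \<one> ((\<lambda>(k, h, g). inv k \<otimes> h \<otimes> g) ` (A \<times> H \<times> insert \<one> F))"
  have W: "finite W" "W \<subseteq> carrier G" "\<one> \<in> W"
    using assms(1,2) H AB by (auto simp: W_def subset_iff)
  have W_mem: "inv k \<otimes> h \<otimes> g \<in> W" if "k \<in> A" "h \<in> H" "g \<in> insert \<one> F" for k h g
    unfolding W_def using that by force
  define P where "P = F \<union> W \<union> conflicts"
  have P: "finite P" "P \<subseteq> carrier G" "\<one> \<in> P" "F \<subseteq> P" "W \<subseteq> P" "conflicts \<subseteq> P"
    using assms(1,2) W conflicts by (auto simp: P_def)
  have "\<epsilon> > 0" "\<delta> > 0" using eps by linarith+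
  then have "\<exists>\<eta>>0. \<forall>u\<in>X. \<forall>w\<in>X. dist u w \<le> \<eta> \<longrightarrow>
      (\<forall>b\<in>B \<union> H. dist (\<alpha> b u) (\<alpha> b w) \<le> min \<epsilon> (\<delta> / 8))"
    using AB H by (intro act_equicontinuous) auto
  then obtain \<eta> where \<eta>: "\<eta> > 0" "\<forall>u\<in>X. \<forall>w\<in>X. dist u w \<le> \<eta> \<longrightarrow>
      (\<forall>b\<in>B \<union> H. dist (\<alpha> b u) (\<alpha> b w) \<le> min \<epsilon> (\<delta> / 8))"
    by (elim exE conjE)
  define D where "D = diameter X"
  have D: "dist u w \<le> D" if "u \<in> X" "w \<in> X" for u w
    unfolding D_def using that compact compact_imp_bounded diameter_bounded_bound by blast
  \<comment> \<open>The first bound preserves half of \<open>J\<close>; the second keeps the squared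
    error from bad vertices within \<open>\<rho>\<close>. The summand 1 covers
    \<open>D = 0\<close>.\<close>
  define \<beta> where "\<beta> = min (q / 2) (\<rho>\<^sup>2 / (4 * (D\<^sup>2 + 1)))"
  have \<beta>: "\<beta> > 0" "\<beta> \<le> q / 2" "4 * \<beta> * D\<^sup>2 \<le> \<rho>\<^sup>2"
  proof -
    have pos: "D\<^sup>2 + 1 > 0" using zero_le_power2[of D] by linarith
    show "\<beta> \<le> q / 2" unfolding \<beta>_def by (rule min.cobounded1)
    show "\<beta> > 0" using assms(3,4) pos by (simp add: \<beta>_def)
    then have "4 * \<beta> * D\<^sup>2 \<le> 4 * \<beta> * (D\<^sup>2 + 1)" by simp
    also have "\<dots> \<le> 4 * (\<rho>\<^sup>2 / (4 * (D\<^sup>2 + 1))) * (D\<^sup>2 + 1)"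
      using pos by (intro mult_right_mono) (auto simp: \<beta>_def)
    also have "\<dots> = \<rho>\<^sup>2"
    proof -
      have "4 * (a / (4 * b)) * b = a" if "b > 0" for a b :: real using that by simp
      then show ?thesis using pos by blast
    qed
    finally show "4 * \<beta> * D\<^sup>2 \<le> \<rho>\<^sup>2" .
  qed
  have n: "n i > 0" for i using sofic by (simp add: sofic_approximation_def)
  have perm: "\<sigma> i g permutes {1..n i}" if "g \<in> carrier G" for i g
    using sofic that by (simp add: sofic_approximation_def sym_group_carrier)
  obtain \<delta>' where \<delta>': "\<delta>' > 0" "\<forall>N s \<phi>. N > 0 \<and> \<phi> \<in> sofic_Map X \<alpha> P \<delta>' N s \<longrightarrow>
    real (card {v\<in>{1..N}. \<exists>g\<in>P. dist (\<phi> (s g v)) (\<alpha> g (\<phi> v)) > \<eta>}) \<le> \<beta> / 2 * real N"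
    using sofic_Map_mostly_equivariant[OF P(1) half_gt_zero[OF \<beta>(1)] \<eta>(1), where X = X and \<alpha> = \<alpha>]
    by (elim exE conjE)
  have ev: "\<forall>\<^sub>F i in sequentially.
      real (card {v\<in>{1..n i}. \<not> sofic_good G P (\<sigma> i) v}) \<le> \<beta> / 2 * real (n i)"
    using \<beta>(1) by (intro eventually_sofic_good[OF sofic P(1,2)]) simp
  show ?thesis
  proof (intro exI[of _ P] exI[of _ \<delta>'] conjI P(1,2) \<delta>'(1) eventually_mono[OF ev] allI impI)
    fix i J
    assume few: "real (card {v\<in>{1..n i}. \<not> sofic_good G P (\<sigma> i) v}) \<le> \<beta> / 2 * real (n i)"
      and J: "independence_set X \<alpha> P \<delta>' (n i) (\<sigma> i) [X \<inter> ball x r] J \<and> real (card J) \<ge> q * real (n i)"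
    let ?s = "\<sigma> i" and ?N = "n i"
    have J_sub: "J \<subseteq> {1..?N}" using J by (simp add: independence_set_def)
    then have fJ: "finite J" using finite_subset by blast
    \<comment> \<open>For a single set there is only one choice function, and it yields one model
      near \<open>x\<close> on all of \<open>J\<close>.\<close>
    have "(\<lambda>a\<in>J. 0) \<in> J \<rightarrow>\<^sub>E {..<length [X \<inter> ball x r]}" by simp
    then obtain \<phi> where \<phi>: "\<phi> \<in> sofic_Map X \<alpha> P \<delta>' ?N ?s"
      and \<phi>J: "\<And>a. a \<in> J \<Longrightarrow> \<phi> a \<in> X \<inter> ball x r"
      using J unfolding independence_set_def by fastforce
    let ?good = "model_good G \<alpha> P \<eta> ?N ?s \<phi>"
    have "{v\<in>{1..?N}. \<not> ?good v} = {v\<in>{1..?N}. \<not> sofic_good G P ?s v} \<union>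
        {v\<in>{1..?N}. \<exists>g\<in>P. dist (\<phi> (?s g v)) (\<alpha> g (\<phi> v)) > \<eta>}"
      by (auto simp: model_good_def not_le)
    then have "real (card {v\<in>{1..?N}. \<not> ?good v}) \<le> real (card {v\<in>{1..?N}. \<not> sofic_good G P ?s v}) +
        real (card {v\<in>{1..?N}. \<exists>g\<in>P. dist (\<phi> (?s g v)) (\<alpha> g (\<phi> v)) > \<eta>})"
      by (simp only: of_nat_add[symmetric] of_nat_le_iff card_Un_le)
    moreover have "real (card {v\<in>{1..?N}. \<exists>g\<in>P. dist (\<phi> (?s g v)) (\<alpha> g (\<phi> v)) > \<eta>}) \<le> \<beta> / 2 * real ?N"
      using \<delta>'(2) \<phi> n by blast
    ultimately have bad: "real (card {v\<in>{1..?N}. \<not> ?good v}) \<le> \<beta> * real ?N"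
      using few by (simp add: field_simps)
    define J1 where "J1 = {a \<in> J. ?good a}"
    have fJ1: "finite J1" using fJ by (simp add: J1_def)
    have "J \<subseteq> J1 \<union> {v\<in>{1..?N}. \<not> ?good v}" using J_sub by (auto simp: J1_def)
    then have "card J \<le> card (J1 \<union> {v\<in>{1..?N}. \<not> ?good v})" using fJ1 by (intro card_mono) auto
    also have "\<dots> \<le> card J1 + card {v\<in>{1..?N}. \<not> ?good v}" by (rule card_Un_le)
    finally have "real (card J) \<le> real (card J1) + real (card {v\<in>{1..?N}. \<not> ?good v})"
      by (simp only: of_nat_add[symmetric] of_nat_le_iff)
    moreover have "\<beta> * real ?N \<le> q / 2 * real ?N" using \<beta>(2) by (intro mult_right_mono) auto
    ultimately have J1_card: "real (card J1) \<ge> q / 2 * real ?N" using J bad by (simp add: field_simps)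
    have one: "?s \<one> a = a" if "?good a" for a
      using sofic_good_one[of P ?s a] that P(3) permutes_inj[OF perm[OF one_closed]]
      by (auto simp: model_good_def)
    have "\<exists>J'\<subseteq>J1. (\<forall>a\<in>J'. \<forall>b\<in>J'. \<forall>t\<in>conflicts. a \<noteq> b \<longrightarrow> ?s t a \<noteq> b) \<and>
        card J1 \<le> (card conflicts + 1) * card J'"
    \<comment> \<open>Edges are reversed by \<open>inv t\<close>, using that good vertices are
      multiplicative and fixed by the image of \<open>\<one>\<close>.\<close>
    proof (rule independent_subset_exists[OF fJ1 conflicts(1), of ?s])
      fix a t assume a: "a \<in> J1" and t: "t \<in> conflicts"
      have tc: "t \<in> carrier G" "inv t \<in> P" "t \<in> P" using t conflicts(2) conflicts_inv P(6) by auto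
      have "?s (inv t \<otimes> t) a = ?s (inv t) (?s t a)"
        using a tc(2,3) unfolding J1_def model_good_def sofic_good_def by blast
      then have "?s (inv t) (?s t a) = a" using tc(1) one a by (simp add: J1_def)
      then show "\<exists>t'\<in>conflicts. ?s t' (?s t a) = a" using conflicts_inv[OF t] by blast
    qed
    then obtain J' where J': "J' \<subseteq> J1"
      "\<forall>a\<in>J'. \<forall>b\<in>J'. \<forall>t\<in>conflicts. a \<noteq> b \<longrightarrow> ?s t a \<noteq> b"
      "card J1 \<le> (card conflicts + 1) * card J'"
      by (elim exE conjE)
    have J'_sub: "a \<in> J" "a \<in> {1..?N}" "?good a" if "a \<in> J'" for a
      using that J'(1) J_sub by (auto simp: J1_def)
    have "independence_set X \<alpha> F \<rho> ?N ?s Us J'"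
      unfolding independence_set_def
    proof (intro conjI ballI)
      show "J' \<subseteq> {1..?N}" using J'_sub by blast
      fix \<omega> assume \<omega>: "\<omega> \<in> J' \<rightarrow>\<^sub>E {..<length Us}"
      then have \<omega>_less: "\<omega> a < length Us" if "a \<in> J'" for a using that by auto
      \<comment> \<open>The same marked vertices and the same \<open>\<phi>\<close> serve for every
        \<open>\<omega>\<close>; only the targets vary.\<close>
      define f where "f a = ys ! \<omega> a" for a
      interpret repair G X \<alpha> c \<epsilon> \<epsilon>' \<delta> A B E x ?N ?s \<phi> F H W P \<eta> J' f
      proof unfold_locales
        show "\<phi> v \<in> X" if "v \<in> {1..?N}" for v
          using \<phi> that by (auto simp: sofic_Map_def)
        show "inv k \<otimes> h \<in> W" if "k \<in> A" "h \<in> H" for k h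
        proof -
          have "k \<in> carrier G" "h \<in> carrier G" using that AB H by auto
          then show ?thesis using W_mem[OF that, of \<one>] by simp
        qed
        show "inv k \<otimes> h \<otimes> g \<in> W" if "k \<in> A" "h \<in> H" "g \<in> F" for k h g
          using W_mem that by blast
        show "?s g permutes {1..?N}" if "g \<in> P" for g using perm P(2) that by blast
        show "dist (\<alpha> b u) (\<alpha> b w) \<le> min \<epsilon> (\<delta> / 8)"
          if "u \<in> X" "w \<in> X" "dist u w \<le> \<eta>" "b \<in> B \<union> H" for u w b
          using \<eta>(2) that by blast
        show "?good a" if "a \<in> J'" for a using J'_sub that by blast
        show "?s t a \<noteq> a'" if "a \<in> J'" "a' \<in> J'" "t \<in> conflicts" "a \<noteq> a'" for a a' t
          using J'(2) that by blast
        show "dist (\<alpha> b (\<phi> a)) (\<alpha> b x) \<le> \<delta> / 8" if "a \<in> J'" "b \<in> B" for a b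
          using r[of "\<phi> a" x b] \<phi>J[of a] J'_sub[of a] that x by (auto simp: dist_commute)
        show "f a \<in> X" if "a \<in> J'" for a using ys(1) \<omega>_less that by (simp add: f_def)
        show "dist (\<alpha> b (f a)) (\<alpha> b x) \<le> \<delta> / 2" if "a \<in> J'" "b \<in> B - A" for a b
          using ys(2) \<omega>_less that by (simp add: f_def)
      qed (use P W H in auto)
      have "\<exists>\<psi>\<in>sofic_Map X \<alpha> F \<rho> ?N ?s. \<forall>a\<in>J'. dist (f a) (\<psi> a) \<le> \<epsilon> + \<epsilon>'"
        using H_small by (intro repaired_Map[OF _ D bad \<beta>(3) n \<open>\<rho> > 0\<close>]) auto
      then obtain \<psi> where \<psi>: "\<psi> \<in> sofic_Map X \<alpha> F \<rho> ?N ?s" "\<forall>a\<in>J'. dist (f a) (\<psi> a) \<le> \<epsilon> + \<epsilon>'"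
        by blast
      have "\<psi> a \<in> Us ! \<omega> a" if a: "a \<in> J'" for a
      proof (rule ys(3)[OF \<omega>_less[OF a]])
        show "\<psi> a \<in> X" using \<psi>(1) J'_sub(2)[OF a] by (auto simp: sofic_Map_def)
        show "dist (ys ! \<omega> a) (\<psi> a) \<le> 2 * \<epsilon>" using \<psi>(2) a eps by (force simp: f_def)
      qed
      then show "\<exists>\<psi>\<in>sofic_Map X \<alpha> F \<rho> ?N ?s. \<forall>a\<in>J'. \<psi> a \<in> Us ! \<omega> a" using \<psi>(1) by blast
    qed
    moreover have "real (card J') \<ge> q / (2 * (real (card conflicts) + 1)) * real ?N"
    proof -
      have "real (card J1) \<le> (real (card conflicts) + 1) * real (card J')"
        using of_nat_mono[OF J'(3), where 'a = real] by (simp add: algebra_simps)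
      then have "q / 2 * real ?N \<le> (real (card conflicts) + 1) * real (card J')"
        using J1_card by linarith
      moreover have "real (card conflicts) + 1 > 0" by linarith
      ultimately show ?thesis by (simp add: field_simps)
    qed
    ultimately show "\<exists>J'. independence_set X \<alpha> F \<rho> ?N ?s Us J' \<and>
        real (card J') \<ge> q / (2 * (real (card conflicts) + 1)) * real ?N" by blast
  qed
qed

end

text \<open>The constants are fixed in the order \<open>\<epsilon>\<close>, \<open>\<delta>\<close>,
  \<open>A\<close>, \<open>B\<close>, \<open>\<epsilon>'\<close>, \<open>E\<close>,
  \<open>r\<close>, \<open>q\<close>, all before \<open>F\<close> and \<open>\<rho>\<close> appear;
  hence the density obtained is uniform in the latter.\<close>

lemma (in expansive_action) asymptotic_positive_density:
  assumes sofic: "sofic_approximation G n \<sigma>"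
    and tmp: "topological_Markov_property G X \<alpha>"
    and IE: "[x] \<in> IE G n \<sigma> X \<alpha> 1"
    and nb: "\<And>j. j < length Us \<Longrightarrow> neighbourhood_in X (ys ! j) (Us ! j)"
    and asym: "\<And>j. j < length Us \<Longrightarrow> (x, ys ! j) \<in> asymptotic_pairs G X \<alpha>"
  shows "positive_upper_independence_density G n \<sigma> X \<alpha> Us"
proof -
  have xX: "x \<in> X" using IE by (simp add: IE_def tuples_def)
  have ysX: "ys ! j \<in> X" if "j < length Us" for j
    using asym[OF that] by (simp add: asymptotic_pairs_def)
  obtain \<epsilon> where \<epsilon>: "\<epsilon> > 0" "\<epsilon> < c / 5"
    "\<forall>j<length Us. \<forall>z\<in>X. dist (ys ! j) z \<le> 2 * \<epsilon> \<longrightarrow> z \<in> Us ! j"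
    using neighbourhoods_common_radius[OF nb, of "c / 5"] c_pos by auto
  have "\<exists>\<delta>>0. \<forall>A. finite A \<and> A \<subseteq> carrier G \<longrightarrow> (\<exists>B. memory_set G X \<alpha> \<epsilon> \<delta> A B)"
    using tmp \<epsilon>(1) by (simp add: topological_Markov_property_def)
  then obtain \<delta> where \<delta>: "\<delta> > 0"
    "\<forall>A. finite A \<and> A \<subseteq> carrier G \<longrightarrow> (\<exists>B. memory_set G X \<alpha> \<epsilon> \<delta> A B)"
    by (elim exE conjE)
  have "\<forall>j\<in>{..<length Us}. \<exists>A. finite A \<and> A \<subseteq> carrier G \<and> \<one> \<in> A \<and>
      (\<forall>g\<in>carrier G - A. dist (\<alpha> g x) (\<alpha> g (ys ! j)) \<le> \<delta> / 2)"
    using asym \<delta>(1) by (intro ballI asymptotic_pairs_window) auto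
  then obtain A0 where A0: "\<forall>j\<in>{..<length Us}. finite (A0 j) \<and> A0 j \<subseteq> carrier G \<and> \<one> \<in> A0 j \<and>
      (\<forall>g\<in>carrier G - A0 j. dist (\<alpha> g x) (\<alpha> g (ys ! j)) \<le> \<delta> / 2)"
    by (rule bchoice[THEN exE])
  \<comment> \<open>One set works for all targets; inserting \<open>\<one>\<close> covers an empty
    list.\<close>
  define A where "A = insert \<one> (\<Union>j<length Us. A0 j)"
  have A: "finite A" "A \<subseteq> carrier G" "\<one> \<in> A" using A0 by (auto simp: A_def)
  obtain B where memory: "memory_set G X \<alpha> \<epsilon> \<delta> A B" using \<delta>(2) A(1,2) by blast
  define \<epsilon>' where "\<epsilon>' = min (\<epsilon> / 2) (\<delta> / 4)"
  have \<epsilon>': "\<epsilon>' > 0" "2 * \<epsilon>' \<le> \<epsilon>" "4 * \<epsilon>' \<le> \<delta>" using \<epsilon> \<delta> by (auto simp: \<epsilon>'_def)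
  obtain E where E: "finite E" "E \<subseteq> carrier G"
     "\<forall>u\<in>X. \<forall>w\<in>X. (\<forall>g\<in>E. dist (\<alpha> g u) (\<alpha> g w) \<le> c) \<longrightarrow> dist u w < \<epsilon>'"
    using expansive_finite_window[OF \<epsilon>'(1)] by (elim exE conjE)
  interpret marking G X \<alpha> c \<epsilon> \<epsilon>' \<delta> A B E x
    by unfold_locales (use \<epsilon> \<epsilon>' E A(3) memory xX in auto)
  have "\<exists>r>0. \<forall>u\<in>X. \<forall>w\<in>X. dist u w \<le> r \<longrightarrow> (\<forall>b\<in>B. dist (\<alpha> b u) (\<alpha> b w) \<le> \<delta> / 8)"
    using AB \<delta>(1) by (intro act_equicontinuous) auto
  then obtain r where r: "r > 0"
    "\<forall>u\<in>X. \<forall>w\<in>X. dist u w \<le> r \<longrightarrow> (\<forall>b\<in>B. dist (\<alpha> b u) (\<alpha> b w) \<le> \<delta> / 8)"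
    by (elim exE conjE)
  have "neighbourhood_in X x (X \<inter> ball x r)"
    unfolding neighbourhood_in_def using xX r
    by (intro conjI exI[of _ "X \<inter> ball x r"]) auto
  then have "positive_upper_independence_density G n \<sigma> X \<alpha> [X \<inter> ball x r]"
    using IE unfolding IE_def by simp
  then obtain q where q: "q > 0" "\<And>F \<delta>. finite F \<and> F \<subseteq> carrier G \<and> \<delta> > 0 \<longrightarrow>
      infinite {i. \<exists>J. independence_set X \<alpha> F \<delta> (n i) (\<sigma> i) [X \<inter> ball x r] J \<and>
        real (card J) \<ge> q * real (n i)}"
    unfolding positive_upper_independence_density_def by blast
  let ?q = "q / (2 * (real (card conflicts) + 1))"
  show ?thesis
    unfolding positive_upper_independence_density_def
  proof (intro exI[of _ ?q] conjI allI impI)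
    show "?q > 0" using q(1) by (simp add: add_nonneg_pos)
    fix F and \<rho> :: real assume F: "finite F \<and> F \<subseteq> carrier G \<and> \<rho> > 0"
    let ?I = "{i. \<exists>J. independence_set X \<alpha> F \<rho> (n i) (\<sigma> i) Us J \<and> real (card J) \<ge> ?q * real (n i)}"
    have "\<exists>P \<delta>'. finite P \<and> P \<subseteq> carrier G \<and> \<delta>' > 0 \<and>
      (\<forall>\<^sub>F i in sequentially. \<forall>J. independence_set X \<alpha> P \<delta>' (n i) (\<sigma> i) [X \<inter> ball x r] J \<and>
        real (card J) \<ge> q * real (n i) \<longrightarrow>
      (\<exists>J'. independence_set X \<alpha> F \<rho> (n i) (\<sigma> i) Us J' \<and> real (card J') \<ge> ?q * real (n i)))"
    proof (rule independence_set_from_model[of F \<rho> q r n \<sigma> Us ys])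
      show "dist (\<alpha> b (ys ! j)) (\<alpha> b x) \<le> \<delta> / 2" if "j < length Us" "b \<in> B - A" for j b
      proof -
        have "b \<in> carrier G - A0 j" using that AB by (auto simp: A_def)
        then show ?thesis using A0 that(1) by (auto simp: dist_commute)
      qed
    qed (use F q r sofic ysX \<epsilon>(3) in auto)
    then obtain P \<delta>' M where P: "finite P" "P \<subseteq> carrier G" "\<delta>' > 0"
      and M: "\<And>i. i \<ge> M \<Longrightarrow> \<forall>J. independence_set X \<alpha> P \<delta>' (n i) (\<sigma> i) [X \<inter> ball x r] J \<and>
        real (card J) \<ge> q * real (n i) \<longrightarrow>
      (\<exists>J'. independence_set X \<alpha> F \<rho> (n i) (\<sigma> i) Us J' \<and> real (card J') \<ge> ?q * real (n i))"
      unfolding eventually_sequentially by (elim exE conjE) metis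
    let ?K = "{i. \<exists>J. independence_set X \<alpha> P \<delta>' (n i) (\<sigma> i) [X \<inter> ball x r] J \<and>
        real (card J) \<ge> q * real (n i)}"
    \<comment> \<open>The transfer holds only for large \<open>i\<close>; discarding finitely many
      indices keeps the set infinite.\<close>
    have "infinite (?K - {..<M})" using q(2) P by (intro Diff_infinite_finite) auto
    moreover have "?K - {..<M} \<subseteq> ?I"
    proof
      fix i assume i: "i \<in> ?K - {..<M}"
      then have "M \<le> i" by simp
      then show "i \<in> ?I" using M[of i] i by blast
    qed
    ultimately show "infinite ?I" using finite_subset by blast
  qed
qed

theorem corollary6p5:
  fixes G :: "('g, 'm) monoid_scheme"
    and n :: "nat \<Rightarrow> nat"
    and \<sigma> :: "nat \<Rightarrow> 'g \<Rightarrow> nat \<Rightarrow> nat"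
    and X :: "'x::metric_space set"
    and \<alpha> :: "'g \<Rightarrow> 'x \<Rightarrow> 'x"
  assumes "group G" and "countable (carrier G)" and "infinite (carrier G)" and "sofic_group G"
    and "sofic_approximation G n \<sigma>"
    and "compact X" and "continuous_action G X \<alpha>"
    and "expansive G X \<alpha>"
    and "topological_Markov_property G X \<alpha>"
  shows "(\<forall>x y. (x, y) \<in> asymptotic_pairs G X \<alpha> \<and> x \<noteq> y \<and> [x] \<in> IE G n \<sigma> X \<alpha> 1 \<longrightarrow>
            [x, y] \<in> IE G n \<sigma> X \<alpha> 2 \<and> sofic_top_entropy G n \<sigma> X \<alpha> > 0)
       \<and> (IE G n \<sigma> X \<alpha> 1 = tuples X 1 \<and> closure (asymptotic_pairs G X \<alpha>) = X \<times> X \<longrightarrow>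
            sofic_UPE_all_orders G n \<sigma> X \<alpha>)"
proof -
  obtain c where c: "c > 0"
    "\<forall>x\<in>X. \<forall>y\<in>X. x \<noteq> y \<longrightarrow> (\<exists>g\<in>carrier G. dist (\<alpha> g x) (\<alpha> g y) > c)"
    using \<open>expansive G X \<alpha>\<close> unfolding expansive_def by blast
  interpret group G by fact
  interpret expansive_action G X \<alpha> c
    by unfold_locales (use assms c in auto)
  note density = asymptotic_positive_density[OF assms(5,9)]
  have n: "n i > 0" for i using assms(5) by (simp add: sofic_approximation_def)
  show ?thesis
  proof (rule conjI; intro allI impI)
    fix x y assume xy: "(x, y) \<in> asymptotic_pairs G X \<alpha> \<and> x \<noteq> y \<and> [x] \<in> IE G n \<sigma> X \<alpha> 1"
    then have xX: "x \<in> X" "y \<in> X" by (auto simp: asymptotic_pairs_def)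
    \<comment> \<open>Both entries of \<open>[x, y]\<close> must be asymptotic to the base point
      \<open>x\<close>, including \<open>x\<close> itself.\<close>
    have xx: "(x, x) \<in> asymptotic_pairs G X \<alpha>"
      using xX by (auto simp: asymptotic_pairs_def)
    have "positive_upper_independence_density G n \<sigma> X \<alpha> Us"
      if Us: "length Us = 2" "\<forall>j<2. neighbourhood_in X ([x, y] ! j) (Us ! j)" for Us
    proof (rule density)
      show "(x, [x, y] ! j) \<in> asymptotic_pairs G X \<alpha>" if "j < length Us" for j
        using that Us(1) xy xx by (auto simp: less_2_cases_iff)
    qed (use Us xy in auto)
    then have "[x, y] \<in> IE G n \<sigma> X \<alpha> 2" using xX by (simp add: IE_def tuples_def)
    then show "[x, y] \<in> IE G n \<sigma> X \<alpha> 2 \<and> sofic_top_entropy G n \<sigma> X \<alpha> > 0"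
      using sofic_top_entropy_pos[of n x y G \<sigma> X \<alpha>] n xy by blast
  next
    assume hyp: "IE G n \<sigma> X \<alpha> 1 = tuples X 1 \<and> closure (asymptotic_pairs G X \<alpha>) = X \<times> X"
    have "xs \<in> IE G n \<sigma> X \<alpha> k" if k: "k \<ge> 2" and xs: "xs \<in> tuples X k" for xs k
    proof -
      have xs': "set xs \<subseteq> X" "length xs = k" using xs by (auto simp: tuples_def)
      have "X \<noteq> {}" using xs' k by (cases xs) auto
      have "positive_upper_independence_density G n \<sigma> X \<alpha> Us"
        if Us: "length Us = k" "\<forall>j<k. neighbourhood_in X (xs ! j) (Us ! j)" for Us
      proof -
        have "\<forall>j\<in>{..<k}. \<exists>T. openin (top_of_set X) T \<and> T \<noteq> {} \<and> T \<subseteq> Us ! j"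
          using Us(2) unfolding neighbourhood_in_def by blast
        then obtain T where T: "\<forall>j\<in>{..<k}. openin (top_of_set X) (T j) \<and> T j \<noteq> {} \<and> T j \<subseteq> Us ! j"
          by (rule bchoice[THEN exE])
        \<comment> \<open>The entries of \<open>xs\<close> need not share an asymptotic partner.
          Points of the open sets \<open>T j\<close> do, and each \<open>Us ! j\<close> is a
          neighbourhood of these points as well.\<close>
        have "\<exists>x\<in>X. \<forall>V\<in>set (map T [0..<k]). \<exists>y\<in>V. (x, y) \<in> asymptotic_pairs G X \<alpha>"
        proof (rule common_asymptotic_partner[OF assms(9) _ \<open>X \<noteq> {}\<close>])
          show "closure (asymptotic_pairs G X \<alpha>) = X \<times> X" using hyp by blast
          show "openin (top_of_set X) V \<and> V \<noteq> {}" if "V \<in> set (map T [0..<k])" for V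
            using that T by auto
        qed
        then obtain x where x: "x \<in> X" "\<forall>j\<in>{..<k}. \<exists>y. y \<in> T j \<and> (x, y) \<in> asymptotic_pairs G X \<alpha>"
          by fastforce
        obtain y where y: "\<forall>j\<in>{..<k}. y j \<in> T j \<and> (x, y j) \<in> asymptotic_pairs G X \<alpha>"
          using bchoice[OF x(2)] by (elim exE)
        show ?thesis
        proof (rule density)
          show "[x] \<in> IE G n \<sigma> X \<alpha> 1" using hyp x(1) by (simp add: tuples_def)
          fix j assume j: "j < length Us"
          then have jk: "j \<in> {..<k}" using Us(1) by simp
          have "Us ! j \<subseteq> X" using Us(2) jk by (simp add: neighbourhood_in_def)
          moreover have "openin (top_of_set X) (T j) \<and> y j \<in> T j \<and> T j \<subseteq> Us ! j"
            using T y jk by blast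
          ultimately have "neighbourhood_in X (y j) (Us ! j)" unfolding neighbourhood_in_def by blast
          then show "neighbourhood_in X (map y [0..<k] ! j) (Us ! j)" using jk by simp
          show "(x, map y [0..<k] ! j) \<in> asymptotic_pairs G X \<alpha>"
            using j Us y by simp
        qed
      qed
      then show ?thesis using xs by (simp add: IE_def)
    qed
    moreover have "IE G n \<sigma> X \<alpha> k \<subseteq> tuples X k" for k by (auto simp: IE_def)
    ultimately show "sofic_UPE_all_orders G n \<sigma> X \<alpha>"
      unfolding sofic_UPE_all_orders_def by blast
  qed
qed

end
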